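(* Let $L:G_{n,p}\rightarrow {\rm GL}(L^2(G_{n,p}))$ be the left regular representation of $G_{n,p}$. Then the eigenvalues of $L({\mathbf B}_1)$ are $0,p,2p,\cdots,np$. The multiplicity of the eigenvalue $ip$ is equal to the number of colored permutations having exactly $i$ fixed points.
   Context: $G_{n,p}=C_p\wr\mathfrak S_n$ is the colored permutation group: its elements are pairs $(s,\sigma)$ with $s=(s_1,\ldots,s_n)\in C_p^n$, $\sigma\in\mathfrak S_n$, with multiplication $(t,\tau)(s,\sigma)=(\sigma t+s,\tau\sigma)$, where $\sigma t=(t_{\sigma(1)},\ldots,t_{\sigma(n)})$. An element $(s,\sigma)$ is regarded as the word $(s_1,\sigma(1))(s_2,\sigma(2))\cdots(s_n,\sigma(n))$ over the alphabet $C_p\times[n]$. For words $u,v$, the shuffle product $u \sqcup\!\sqcup v$ denotes the formal sum of all interleavings of $u$ and $v$ (preserving the internal order of letters of each). Let $W_{k,n}=(0,k+1)(0,k+2)\cdots(0,n)$. Define ${\mathbf B}_1=\sum_{\alpha\in G_{1,p}}\alpha \sqcup\!\sqcup W_{1,n}=\sum_{j=0}^{p-1}(j,1)\sqcup\!\sqcup W_{1,n}\in{\mathbb Q}G_{n,p}$ (for $n\ge 2$); $\frac{1}{np}{\mathbf B}_1$ is the top-to-random shuffle on $G_{n,p}$ (take the top card, change its color by a uniformly random element of $C_p$, insert at a uniformly random position). An element $(s,\sigma)$ has a fixed point at $i$ if $s_i=0$ and $\sigma(i)=i$.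
   Formalization: That the eigenvalues are exactly 0,p,…,np is stated for p ≥ 2; for p = 1 the value n−1 has multiplicity 0 and is not an eigenvalue, so there only containment in the list is stated, with the multiplicity formula (possibly 0) for every i. *)

theory Defs
  imports
    Complex_Main
    "HOL-Library.FuncSet"
    "HOL-Library.Function_Algebras"
    "HOL-Library.Multiset"
    "HOL-Combinatorics.Permutations"
    "HOL-Algebra.Elementary_Groups"
begin

section \<open>Colored permutation groups\<close>

type_synonym colored_perm = "(nat \<Rightarrow> int) \<times> (nat \<Rightarrow> nat)"

text \<open>
  The wreath product of \<open>C\<^sub>p\<close> with the symmetric group on \<open>{1..n}\<close>.  Colorings are extensional
  functions on \<open>{1..n}\<close>, and permutations are the identity outside \<open>{1..n}\<close>, so that equality
  of group elements is equality in HOL.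
\<close>

definition colored_perm_group :: "nat \<Rightarrow> nat \<Rightarrow> colored_perm monoid" where
  "colored_perm_group n p =
    \<lparr>carrier = ({1..n} \<rightarrow>\<^sub>E carrier (integer_mod_group p)) \<times> {\<sigma>. \<sigma> permutes {1..n}},
     monoid.mult = (\<lambda>(t, \<tau>) (s, \<sigma>).
       (\<lambda>i\<in>{1..n}. t (\<sigma> i) \<otimes>\<^bsub>integer_mod_group p\<^esub> s i, \<tau> \<circ> \<sigma>)),
     one = (\<lambda>i\<in>{1..n}. \<one>\<^bsub>integer_mod_group p\<^esub>, id)\<rparr>"

lemma group_colored_perm_group: "group (colored_perm_group n p)"
proof (rule groupI)
  let ?G = "colored_perm_group n p" and ?C = "integer_mod_group p"
  interpret C: group ?C by simp
  show "x \<otimes>\<^bsub>?G\<^esub> y \<in> carrier ?G" if "x \<in> carrier ?G" "y \<in> carrier ?G" for x y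
  proof -
    obtain t \<tau> s \<sigma> where xy: "x = (t, \<tau>)" "y = (s, \<sigma>)" by (cases x, cases y)
    have s: "t \<in> {1..n} \<rightarrow>\<^sub>E carrier ?C" "\<tau> permutes {1..n}" "s \<in> {1..n} \<rightarrow>\<^sub>E carrier ?C" "\<sigma> permutes {1..n}"
      using that by (auto simp: xy colored_perm_group_def)
    have "t (\<sigma> i) \<otimes>\<^bsub>?C\<^esub> s i \<in> carrier ?C" if "i \<in> {1..n}" for i
    proof (rule C.m_closed)
      show "t (\<sigma> i) \<in> carrier ?C" using s(1) permutes_in_image[OF s(4)] that by blast
      show "s i \<in> carrier ?C" using s(3) that by blast
    qed
    then show ?thesis
      using permutes_compose[OF s(4) s(2)] by (simp add: xy colored_perm_group_def del: mult_integer_mod_group)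
  qed
  show one: "\<one>\<^bsub>?G\<^esub> \<in> carrier ?G"
    by (auto simp: colored_perm_group_def permutes_id)
  show "x \<otimes>\<^bsub>?G\<^esub> y \<otimes>\<^bsub>?G\<^esub> z = x \<otimes>\<^bsub>?G\<^esub> (y \<otimes>\<^bsub>?G\<^esub> z)"
    if "x \<in> carrier ?G" "y \<in> carrier ?G" "z \<in> carrier ?G" for x y z
  proof -
    obtain t \<tau> s \<sigma> r \<rho> where xyz: "x = (t, \<tau>)" "y = (s, \<sigma>)" "z = (r, \<rho>)"
      by (cases x, cases y, cases z)
    have "\<rho> permutes {1..n}" using that by (simp add: xyz colored_perm_group_def)
    then have "\<rho> i \<in> {1..n}" if "i \<in> {1..n}" for i
      using permutes_in_image that by metis
    then show ?thesis
      by (auto simp: xyz colored_perm_group_def fun_eq_iff restrict_def mod_simps algebra_simps)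
  qed
  show "\<one>\<^bsub>?G\<^esub> \<otimes>\<^bsub>?G\<^esub> x = x" if "x \<in> carrier ?G" for x
  proof -
    obtain s \<sigma> where x: "x = (s, \<sigma>)" by (cases x)
    have s: "s \<in> {1..n} \<rightarrow>\<^sub>E carrier ?C" "\<sigma> permutes {1..n}"
      using that by (auto simp: x colored_perm_group_def)
    have "\<one>\<^bsub>?C\<^esub> \<otimes>\<^bsub>?C\<^esub> s i = s i" if "i \<in> {1..n}" for i
      using s(1) that by (intro C.l_one) blast
    then show ?thesis
      using s permutes_in_image[OF s(2)]
      by (auto simp: x colored_perm_group_def fun_eq_iff restrict_def PiE_def extensional_def)
  qed
  show "\<exists>y\<in>carrier ?G. y \<otimes>\<^bsub>?G\<^esub> x = \<one>\<^bsub>?G\<^esub>" if "x \<in> carrier ?G" for x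
  proof -
    obtain s \<sigma> where x: "x = (s, \<sigma>)" by (cases x)
    have s: "s \<in> {1..n} \<rightarrow>\<^sub>E carrier ?C" "\<sigma> permutes {1..n}"
      using that by (auto simp: x colored_perm_group_def)
    define \<tau> where "\<tau> = Hilbert_Choice.inv \<sigma>"
    define t where "t = (\<lambda>i\<in>{1..n}. inv\<^bsub>?C\<^esub> (s (\<tau> i)))"
    have \<tau>: "\<tau> permutes {1..n}" unfolding \<tau>_def by (rule permutes_inv[OF s(2)])
    have in_C: "s i \<in> carrier ?C" if "i \<in> {1..n}" for i using s(1) that by blast
    have "t \<in> {1..n} \<rightarrow>\<^sub>E carrier ?C"
      unfolding t_def
    proof (rule restrict_PiE_iff[THEN iffD2], intro ballI C.inv_closed in_C)
      show "\<tau> i \<in> {1..n}" if "i \<in> {1..n}" for i using permutes_in_image[OF \<tau>] that by metis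
    qed
    moreover have "t (\<sigma> i) \<otimes>\<^bsub>?C\<^esub> s i = \<one>\<^bsub>?C\<^esub>" if "i \<in> {1..n}" for i
    proof -
      have "t (\<sigma> i) = inv\<^bsub>?C\<^esub> (s i)"
        using permutes_in_image[OF s(2), of i] that permutes_inverses(2)[OF s(2)]
        by (auto simp: t_def \<tau>_def)
      then show ?thesis using C.l_inv[OF in_C[OF that]] by metis
    qed
    moreover have "\<tau> \<circ> \<sigma> = id" unfolding \<tau>_def by (rule permutes_inv_o(2)[OF s(2)])
    ultimately show ?thesis
      using \<tau> by (intro bexI[of _ "(t, \<tau>)"])
        (auto simp: x colored_perm_group_def fun_eq_iff restrict_def simp del: mult_integer_mod_group)
  qed
qed

definition fixed_points :: "nat \<Rightarrow> colored_perm \<Rightarrow> nat set" where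
  "fixed_points n = (\<lambda>(s, \<sigma>). {i \<in> {1..n}. s i = 0 \<and> \<sigma> i = i})"

section \<open>Words and shuffle products\<close>

definition word_of :: "nat \<Rightarrow> colored_perm \<Rightarrow> (int \<times> nat) list" where
  "word_of n = (\<lambda>(s, \<sigma>). map (\<lambda>i. (s i, \<sigma> i)) [1..<Suc n])"

text \<open>
  The formal sum of all interleavings of two words, as a multiset: interleavings are counted with
  multiplicity, in contrast to the set \<^const>\<open>shuffles\<close>.
\<close>

fun shuffle_product :: "'a list \<Rightarrow> 'a list \<Rightarrow> 'a list multiset" where
  "shuffle_product [] v = {#v#}"
| "shuffle_product u [] = {#u#}"
| "shuffle_product (a # u) (b # v) =
     image_mset ((#) a) (shuffle_product u (b # v)) + image_mset ((#) b) (shuffle_product (a # u) v)"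

definition W :: "nat \<Rightarrow> nat \<Rightarrow> (int \<times> nat) list" where
  "W k n = map (\<lambda>i. (0, i)) [Suc k..<Suc n]"

text \<open>
  Elements of the rational group algebra are given by their coefficient functions; the coefficient
  of a group element is that of its word in the formal sum of words.
\<close>

definition B1 :: "nat \<Rightarrow> nat \<Rightarrow> colored_perm \<Rightarrow> rat" where
  "B1 n p = (\<lambda>g. \<Sum>\<alpha>\<in>carrier (colored_perm_group 1 p).
     of_nat (count (shuffle_product (word_of 1 \<alpha>) (W 1 n)) (word_of n g)))"

section \<open>The left regular representation\<close>

text \<open>
  Complex functions on the carrier of \<open>G\<close>, extended by zero to the whole type.
\<close>

definition L2 :: "('a, 'b) monoid_scheme \<Rightarrow> ('a \<Rightarrow> complex) set" where
  "L2 G = {f. \<forall>x. x \<notin> carrier G \<longrightarrow> f x = 0}"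

definition left_regular :: "('a, 'b) monoid_scheme \<Rightarrow> 'a \<Rightarrow> ('a \<Rightarrow> complex) \<Rightarrow> ('a \<Rightarrow> complex)" where
  "left_regular G g f = (\<lambda>x. if x \<in> carrier G then f (inv\<^bsub>G\<^esub> g \<otimes>\<^bsub>G\<^esub> x) else 0)"

text \<open>The linear extension of the left regular representation to the rational group algebra.\<close>

definition left_regular_algebra ::
    "('a, 'b) monoid_scheme \<Rightarrow> ('a \<Rightarrow> rat) \<Rightarrow> ('a \<Rightarrow> complex) \<Rightarrow> ('a \<Rightarrow> complex)" where
  "left_regular_algebra G b f = (\<lambda>x. \<Sum>g\<in>carrier G. of_rat (b g) * left_regular G g f x)"

section \<open>Eigenvalues and multiplicities\<close>

definition scale_fun :: "complex \<Rightarrow> ('a \<Rightarrow> complex) \<Rightarrow> ('a \<Rightarrow> complex)" where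
  "scale_fun c f = (\<lambda>x. c * f x)"

interpretation fun_space: vector_space scale_fun
  by unfold_locales (auto simp: scale_fun_def fun_eq_iff algebra_simps)

text \<open>
  In the following, \<open>T\<close> is a linear operator on the finite-dimensional space \<open>V\<close> of functions.
\<close>

definition eigenvalues ::
    "('a \<Rightarrow> complex) set \<Rightarrow> (('a \<Rightarrow> complex) \<Rightarrow> ('a \<Rightarrow> complex)) \<Rightarrow> complex set" where
  "eigenvalues V T = {c. \<exists>f\<in>V. f \<noteq> 0 \<and> T f = scale_fun c f}"

definition geometric_multiplicity ::
    "('a \<Rightarrow> complex) set \<Rightarrow> (('a \<Rightarrow> complex) \<Rightarrow> ('a \<Rightarrow> complex)) \<Rightarrow> complex \<Rightarrow> nat" where
  "geometric_multiplicity V T c = fun_space.dim {f \<in> V. T f = scale_fun c f}"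

definition algebraic_multiplicity ::
    "('a \<Rightarrow> complex) set \<Rightarrow> (('a \<Rightarrow> complex) \<Rightarrow> ('a \<Rightarrow> complex)) \<Rightarrow> complex \<Rightarrow> nat" where
  "algebraic_multiplicity V T c =
     fun_space.dim {f \<in> V. \<exists>k. ((\<lambda>h. T h - scale_fun c h) ^^ k) f = 0}"

end

theory Submission
  imports Defs
begin

text \<open>
  Let \<open>B\<^sub>k\<close> be the sum of \<open>\<alpha> \<squnion>\<squnion> W k n\<close> over the words \<open>\<alpha>\<close> of the group on \<open>k\<close> letters. Then
  \<open>B\<^sub>1 B\<^sub>k = k p B\<^sub>k + B\<^sub>k\<^sub>+\<^sub>1\<close> for \<open>k < n\<close> and \<open>B\<^sub>1 B\<^sub>n = n p B\<^sub>n\<close>, so \<open>B\<^sub>k\<close> is the falling factorial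
  \<open>B\<^sub>1 (B\<^sub>1 - p) \<cdots> (B\<^sub>1 - (k - 1) p)\<close> and \<open>B\<^sub>1\<close> is annihilated by the polynomial with the simple roots
  \<open>0, p, \<dots>, n p\<close>. Hence \<open>L(B\<^sub>1)\<close> is diagonalizable, and its spectral projections are
  \<open>P\<^sub>i = \<Sum>\<^sub>k (-1)\<^sup>k\<^sup>-\<^sup>i (k choose i) L(B\<^sub>k) / (p\<^sup>k k!)\<close>. The identity has coefficient \<open>1\<close> in every \<open>B\<^sub>k\<close>,
  so \<open>L(B\<^sub>k)\<close> has trace \<open>p\<^sup>n n!\<close>. This is also \<open>p\<^sup>k k!\<close> times the number of pairs of a colored
  permutation and a \<open>k\<close>-subset of its fixed points, so the dimension, that is the trace of
  \<open>P\<^sub>i\<close>, is the inclusion-exclusion count of colored permutations with exactly \<open>i\<close> fixed points.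
\<close>

section \<open>Traces and binomial inversion\<close>

lemma sum_fun_eval: "(\<Sum>i\<in>I. f i) x = (\<Sum>i\<in>I. (f i x :: 'b :: comm_monoid_add))"
  by (induction I rule: infinite_finite_induct) auto

text \<open>The kernel \<open>K\<close> maps into the span of \<open>E\<close> and fixes
  \<open>E\<close>, so it is a projection, and the trace of a projection is the dimension of its
  image.\<close>

lemma dim_eq_trace:
  fixes K :: "'a \<Rightarrow> 'a \<Rightarrow> complex"
  assumes "finite A"
    and columns: "\<And>y. y \<in> A \<Longrightarrow> (\<lambda>x. K x y) \<in> E"
    and reproduces: "\<And>f. f \<in> E \<Longrightarrow> (\<lambda>x. \<Sum>y\<in>A. K x y * f y) = f"
  shows "of_nat (fun_space.dim E) = (\<Sum>y\<in>A. K y y)"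
proof -
  obtain B where B: "B \<subseteq> E" "fun_space.independent B" "E \<subseteq> fun_space.span B" "card B = fun_space.dim E"
    using fun_space.basis_exists by metis
  let ?col = "\<lambda>y x. K x y" and ?r = "fun_space.representation B"
  have expand: "f = (\<Sum>y\<in>A. scale_fun (f y) (?col y))" if "f \<in> E" for f
    using reproduces[OF that] by (simp add: fun_eq_iff sum_fun_eval scale_fun_def mult.commute)
  have "E \<subseteq> fun_space.span (?col ` A)"
  proof
    fix f assume "f \<in> E"
    have "(\<Sum>y\<in>A. scale_fun (f y) (?col y)) \<in> fun_space.span (?col ` A)"
      by (intro fun_space.span_sum fun_space.span_scale fun_space.span_base) auto
    then show "f \<in> fun_space.span (?col ` A)" using expand[OF \<open>f \<in> E\<close>] by simp
  qed
  then have "finite B"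
    using fun_space.independent_span_bound[of "?col ` A" B] B(1,2) \<open>finite A\<close> by auto
  have span: "?col y \<in> fun_space.span B" if "y \<in> A" for y using columns[OF that] B(3) by auto
  \<comment> \<open>The \<open>b\<close>-coordinate of \<open>b\<close> itself, read off from its
    expansion in the columns. These ones add up to \<open>card B\<close>, while expanding each
    column in \<open>B\<close> identifies the same double sum with the trace.\<close>
  have diag: "(\<Sum>y\<in>A. b y * ?r (?col y) b) = 1" if "b \<in> B" for b
  proof -
    have "b = (\<Sum>y\<in>A. scale_fun (b y) (?col y))" using expand that B(1) by auto
    then have "?r b b = ?r (\<Sum>y\<in>A. scale_fun (b y) (?col y)) b" by simp
    also have "\<dots> = (\<Sum>y\<in>A. b y * ?r (?col y) b)"
      using B(2) span
      by (simp add: fun_space.representation_sum fun_space.span_scale fun_space.representation_scale)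
    finally show ?thesis using fun_space.representation_basis[OF B(2) that] by simp
  qed
  have "(\<Sum>y\<in>A. K y y) = (\<Sum>y\<in>A. \<Sum>b\<in>B. ?r (?col y) b * b y)"
  proof (rule sum.cong)
    fix y assume "y \<in> A"
    have "(\<Sum>b\<in>B. scale_fun (?r (?col y) b) b) = ?col y"
      using fun_space.sum_representation_eq[OF B(2) span[OF \<open>y \<in> A\<close>] \<open>finite B\<close>] by simp
    from fun_cong[OF this, of y] show "K y y = (\<Sum>b\<in>B. ?r (?col y) b * b y)"
      by (simp add: sum_fun_eval scale_fun_def)
  qed simp
  also have "\<dots> = (\<Sum>b\<in>B. \<Sum>y\<in>A. b y * ?r (?col y) b)"
    by (subst sum.swap) (simp add: mult.commute)
  also have "\<dots> = of_nat (card B)" using diag by simp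
  finally show ?thesis using B(4) by simp
qed

text \<open>The identity \<open>(N choose k) * (k choose i) = (N choose i) * (N - i choose (k -
  i))\<close> leaves an alternating sum over a row of Pascal's triangle. The bound \<open>n\<close>
  is uniform in \<open>N\<close>, so that this sum can be exchanged with one over group
  elements.\<close>

lemma sum_alternating_choose_choose:
  assumes "N \<le> n"
  shows "(\<Sum>k\<le>n. (-1) ^ (k + i) * of_nat (k choose i) * of_nat (N choose k))
    = (if N = i then 1 else 0 :: 'a :: comm_ring_1)"
proof (cases "i \<le> N")
  case True
  have "(\<Sum>k\<le>n. (-1) ^ (k + i) * of_nat (k choose i) * of_nat (N choose k))
      = (\<Sum>k\<in>{i..N}. (-1) ^ (k + i) * of_nat (k choose i) * (of_nat (N choose k) :: 'a))"
    using assms by (intro sum.mono_neutral_right) (auto simp: not_le binomial_eq_0)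
  also have "\<dots> = (\<Sum>l\<le>N - i. (-1) ^ l * of_nat (N - i choose l) * of_nat (N choose i))"
  proof (rule sum.reindex_bij_witness[where i = "\<lambda>l. l + i" and j = "\<lambda>k. k - i"])
    fix k assume k: "k \<in> {i..N}"
    then have "(N choose k) * (k choose i) = (N choose i) * (N - i choose (k - i))"
      by (simp add: choose_mult)
    from arg_cong[OF this, of "of_nat :: nat \<Rightarrow> 'a"]
    have "of_nat (k choose i) * of_nat (N choose k)
        = of_nat (N - i choose (k - i)) * (of_nat (N choose i) :: 'a)"
      by (simp add: mult.commute)
    moreover have "(-1 :: 'a) ^ (k + i) = (-1) ^ (k - i)"
      using k by (simp add: minus_one_power_iff)
    ultimately show "(-1) ^ (k - i) * of_nat (N - i choose (k - i)) * of_nat (N choose i)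
        = (-1) ^ (k + i) * of_nat (k choose i) * (of_nat (N choose k) :: 'a)"
      by (simp add: mult.assoc)
  qed (use True in auto)
  also have "\<dots> = (if N = i then 1 else 0)"
    using choose_alternating_sum[of "N - i", where ?'a = 'a] True
    by (auto simp flip: sum_distrib_right)
  finally show ?thesis .
next
  case False
  have "(\<Sum>k\<le>n. (-1) ^ (k + i) * of_nat (k choose i) * (of_nat (N choose k) :: 'a)) = 0"
  proof (rule sum.neutral, intro ballI)
    fix k
    show "(-1) ^ (k + i) * of_nat (k choose i) * (of_nat (N choose k) :: 'a) = 0"
      using False by (cases "k < i") (auto simp: binomial_eq_0)
  qed
  then show ?thesis using False by simp
qed

text \<open>For \<open>i\<close> and \<open>k\<close> up to \<open>n\<close>: the coefficients of
  the Lagrange polynomial of the node \<open>i p\<close> among \<open>0, p, ..., n p\<close>,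
  written in the falling factorials \<open>x (x - p) ... (x - (k - 1) p)\<close>. The exponent
  \<open>k + i\<close> has the parity of \<open>k - i\<close> and avoids truncated
  subtraction.\<close>

definition inversion_coeff :: "nat \<Rightarrow> nat \<Rightarrow> nat \<Rightarrow> complex" where
  "inversion_coeff p i k = (-1) ^ (k + i) * of_nat (k choose i) / (of_nat p ^ k * fact k)"

text \<open>Comparison of the coefficients of \<open>U (Suc k)\<close> in the eigenvalue equation of
  \<open>P i\<close>; it rests on
  \<open>(k + 1 - i) * (k + 1 choose i) = (k + 1) * (k choose i)\<close>.\<close>

lemma inversion_coeff_Suc:
  assumes "p > 0"
  shows "inversion_coeff p i k + of_nat (Suc k * p) * inversion_coeff p i (Suc k)
    = of_nat (i * p) * inversion_coeff p i (Suc k)"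
proof -
  have "of_nat (Suc k - i) * of_nat (Suc k choose i) = of_nat (Suc k) * (of_nat (k choose i) :: complex)"
    using arg_cong[OF binomial_absorb_comp[of "Suc k" i], of "of_nat :: nat \<Rightarrow> complex"]
    by (simp add: distrib_right)
  \<comment> \<open>Truncated subtraction becomes ring subtraction; for \<open>i > Suc k\<close>
    both binomials vanish.\<close>
  then have *: "(of_nat (Suc k) - of_nat i) * of_nat (Suc k choose i)
      = of_nat (Suc k) * (of_nat (k choose i) :: complex)"
    by (cases "i \<le> Suc k") (simp_all add: of_nat_diff binomial_eq_0)
  have "of_nat p * (of_nat (Suc k) - of_nat i) * inversion_coeff p i (Suc k)
      = - ((-1) ^ (k + i)) * (of_nat p * (of_nat (Suc k) * of_nat (k choose i)))
          / (of_nat p ^ Suc k * fact (Suc k))"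
    unfolding inversion_coeff_def * [symmetric] by simp
  also have "\<dots> = - inversion_coeff p i k"
    using assms by (simp add: inversion_coeff_def fact_Suc del: of_nat_Suc)
  finally show ?thesis by (simp add: algebra_simps)
qed

text \<open>Alternating row sums of Pascal's triangle vanish for \<open>k > 0\<close>. Consequently
  the operators \<open>P i\<close> add up to \<open>U 0\<close>.\<close>

lemma sum_inversion_coeff:
  assumes "k \<le> n"
  shows "(\<Sum>i\<le>n. inversion_coeff p i k) = (if k = 0 then 1 else 0)"
proof -
  have "(\<Sum>i\<le>n. inversion_coeff p i k)
      = (\<Sum>i\<le>n. (-1) ^ i * of_nat (k choose i)) * ((-1) ^ k / (of_nat p ^ k * fact k))"
    unfolding sum_distrib_right
    by (rule sum.cong) (simp_all add: inversion_coeff_def power_add)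
  also have "(\<Sum>i\<le>n. (-1) ^ i * of_nat (k choose i)) = (\<Sum>i\<le>k. (-1) ^ i * (of_nat (k choose i) :: complex))"
    using assms by (intro sum.mono_neutral_right) auto
  also have "\<dots> = (if k = 0 then 1 else 0)"
    using choose_alternating_sum[of k, where ?'a = complex] by auto
  finally show ?thesis by simp
qed

section \<open>Diagonalization from falling factorials\<close>

text \<open>
  The kernels \<open>R k\<close> represent the falling factorials \<open>T (T - p) \<cdots> (T - (k - 1) p)\<close>, of which the
  one of order \<open>n + 1\<close> vanishes.
\<close>

locale falling_factorial_family =
  fixes A :: "'a set"
    and T :: "('a \<Rightarrow> complex) \<Rightarrow> 'a \<Rightarrow> complex"
    and R :: "nat \<Rightarrow> 'a \<Rightarrow> 'a \<Rightarrow> complex"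
    and n p :: nat
  assumes finite_A: "finite A"
    and p_pos: "p > 0"
    and linear_T: "Vector_Spaces.linear scale_fun scale_fun T"
    and R_outside: "x \<notin> A \<Longrightarrow> R k x y = 0"
    and R_0: "x \<in> A \<Longrightarrow> y \<in> A \<Longrightarrow> R 0 x y = (if x = y then 1 else 0)"
    and R_eq_0: "k > n \<Longrightarrow> R k x y = 0"
    and T_R: "y \<in> A \<Longrightarrow> T (\<lambda>x. R k x y) = (\<lambda>x. of_nat (k * p) * R k x y + R (Suc k) x y)"
begin

definition V :: "('a \<Rightarrow> complex) set" where
  "V = {f. \<forall>x. x \<notin> A \<longrightarrow> f x = 0}"

definition E :: "complex \<Rightarrow> ('a \<Rightarrow> complex) set" where
  "E c = {f \<in> V. T f = scale_fun c f}"

definition U :: "nat \<Rightarrow> ('a \<Rightarrow> complex) \<Rightarrow> 'a \<Rightarrow> complex" where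
  "U k f = (\<lambda>x. \<Sum>y\<in>A. R k x y * f y)"

text \<open>
  \<open>U k\<close> acts on the eigenspace of \<open>j p\<close> as \<open>p\<^sup>k k! (j choose k)\<close>; binomial inversion turns these
  operators into the spectral projections \<open>P i\<close>.
\<close>

definition P :: "nat \<Rightarrow> ('a \<Rightarrow> complex) \<Rightarrow> 'a \<Rightarrow> complex" where
  "P i f = (\<lambda>x. \<Sum>k\<le>n. inversion_coeff p i k * U k f x)"

definition K :: "nat \<Rightarrow> 'a \<Rightarrow> 'a \<Rightarrow> complex" where
  "K i x y = (\<Sum>k\<le>n. inversion_coeff p i k * R k x y)"

lemma P_eq_K: "P i f = (\<lambda>x. \<Sum>y\<in>A. K i x y * f y)"
  unfolding P_def U_def K_def sum_distrib_left sum_distrib_right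
  by (subst sum.swap) (simp add: mult.assoc)

lemma P_lincomb: "P j (\<lambda>x. \<Sum>i\<in>I. c i * f i x) = (\<lambda>x. \<Sum>i\<in>I. c i * P j (f i) x)"
  unfolding P_eq_K sum_distrib_left by (subst sum.swap) (simp add: mult_ac)

lemma T_lincomb: "T (\<lambda>x. \<Sum>i\<in>I. c i * f i x) = (\<lambda>x. \<Sum>i\<in>I. c i * T (f i) x)"
proof -
  interpret T: Vector_Spaces.linear scale_fun scale_fun T by (rule linear_T)
  have "(\<lambda>x. \<Sum>i\<in>I. c i * f i x) = (\<Sum>i\<in>I. scale_fun (c i) (f i))"
    by (simp add: fun_eq_iff sum_fun_eval scale_fun_def)
  then have "T (\<lambda>x. \<Sum>i\<in>I. c i * f i x) = (\<Sum>i\<in>I. scale_fun (c i) (T (f i)))"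
    by (simp add: T.sum T.scale)
  then show ?thesis by (simp add: fun_eq_iff sum_fun_eval scale_fun_def)
qed

lemma T_scale: "T (scale_fun c f) = scale_fun c (T f)"
proof -
  interpret T: Vector_Spaces.linear scale_fun scale_fun T by (rule linear_T)
  show ?thesis by (rule T.scale)
qed

text \<open>\<open>U k f\<close> is a linear combination of columns of \<open>R k\<close>, so the
  recurrence of the columns carries over by linearity.\<close>

lemma T_U: "T (U k f) = (\<lambda>x. of_nat (k * p) * U k f x + U (Suc k) f x)"
proof -
  have "T (U k f) = T (\<lambda>x. \<Sum>y\<in>A. f y * R k x y)" by (simp add: U_def mult.commute)
  also have "\<dots> = (\<lambda>x. \<Sum>y\<in>A. f y * (of_nat (k * p) * R k x y + R (Suc k) x y))"
    unfolding T_lincomb by (simp add: T_R fun_eq_iff cong: sum.cong)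
  also have "\<dots> = (\<lambda>x. of_nat (k * p) * U k f x + U (Suc k) f x)"
    by (simp add: U_def fun_eq_iff sum_distrib_left sum.distrib algebra_simps)
  finally show ?thesis .
qed

lemma U_0: "f \<in> V \<Longrightarrow> U 0 f = f"
proof
  fix x assume "f \<in> V"
  show "U 0 f x = f x"
  proof (cases "x \<in> A")
    case True
    then have "U 0 f x = (\<Sum>y\<in>A. if x = y then f y else 0)"
      unfolding U_def by (intro sum.cong) (simp_all add: R_0)
    then show ?thesis using True finite_A by simp
  next
    case False
    then show ?thesis using \<open>f \<in> V\<close> by (simp add: U_def V_def R_outside)
  qed
qed

lemma P_in_V: "P i f \<in> V"
  by (simp add: V_def P_def U_def R_outside)

text \<open>Applying \<open>T\<close> replaces \<open>U k\<close> by
  \<open>k p U k + U (Suc k)\<close>; after an index shift the coefficients agree by the recurrence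
  of \<open>inversion_coeff\<close>.\<close>

lemma T_P: "T (P i f) = scale_fun (of_nat (i * p)) (P i f)"
proof
  fix x
  let ?a = "inversion_coeff p i"
  \<comment> \<open>The case expression supplies the coefficient 0 below index 0; at the other end
    \<open>U (Suc n)\<close> vanishes.\<close>
  have shift: "(\<Sum>k\<le>n. ?a k * U (Suc k) f x)
      = (\<Sum>k\<le>n. (case k of 0 \<Rightarrow> 0 | Suc l \<Rightarrow> ?a l) * U k f x)"
  proof -
    have "(\<Sum>k\<le>n. ?a k * U (Suc k) f x)
        = (\<Sum>k\<le>Suc n. (case k of 0 \<Rightarrow> 0 | Suc l \<Rightarrow> ?a l) * U k f x)"
      by (subst sum.atMost_Suc_shift) simp
    then show ?thesis by (simp add: U_def R_eq_0)
  qed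
  \<comment> \<open>At \<open>k = 0\<close> the left side is 0, and so is the right side: either
    \<open>i = 0\<close> or \<open>?a 0 = 0\<close>.\<close>
  have coeff: "(case k of 0 \<Rightarrow> 0 | Suc l \<Rightarrow> ?a l) + of_nat (k * p) * ?a k = of_nat (i * p) * ?a k" for k
  proof (cases k)
    case 0
    then show ?thesis by (cases "i = 0") (simp_all add: inversion_coeff_def)
  next
    case (Suc l)
    then show ?thesis using inversion_coeff_Suc[OF p_pos, of i l] by simp
  qed
  have "T (P i f) x = (\<Sum>k\<le>n. ?a k * (of_nat (k * p) * U k f x + U (Suc k) f x))"
    unfolding P_def T_lincomb T_U by simp
  also have "\<dots> = (\<Sum>k\<le>n. ?a k * U (Suc k) f x) + (\<Sum>k\<le>n. of_nat (k * p) * ?a k * U k f x)"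
    by (simp add: sum.distrib algebra_simps)
  also have "\<dots> = (\<Sum>k\<le>n. of_nat (i * p) * ?a k * U k f x)"
    unfolding shift sum.distrib[symmetric] distrib_right[symmetric] coeff ..
  also have "\<dots> = scale_fun (of_nat (i * p)) (P i f) x"
    by (simp add: P_def scale_fun_def sum_distrib_left mult.assoc)
  finally show "T (P i f) x = scale_fun (of_nat (i * p)) (P i f) x" .
qed

lemma P_in_E: "P i f \<in> E (of_nat (i * p))"
  using P_in_V T_P by (simp add: E_def)

lemma sum_P:
  assumes "f \<in> V"
  shows "(\<Sum>i\<le>n. P i f x) = f x"
proof -
  have "(\<Sum>i\<le>n. P i f x) = (\<Sum>k\<le>n. (\<Sum>i\<le>n. inversion_coeff p i k) * U k f x)"
    unfolding P_def sum_distrib_right by (rule sum.swap)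
  also have "\<dots> = (\<Sum>k\<le>n. if k = 0 then U k f x else 0)"
    by (rule sum.cong) (simp_all add: sum_inversion_coeff)
  also have "\<dots> = f x" using U_0[OF assms] by simp
  finally show ?thesis .
qed

text \<open>\<open>U (Suc k)\<close> arises from \<open>U k\<close> by applying
  \<open>T - k p\<close>, and \<open>T\<close> maps multiples of an eigenvector to multiples of
  it.\<close>

lemma U_eigenvector:
  assumes "f \<in> E c"
  shows "\<exists>t. U k f = scale_fun t f"
proof (induction k)
  case 0
  have "U 0 f = scale_fun 1 f" using assms U_0 by (simp add: E_def)
  then show ?case ..
next
  case (Suc k)
  then obtain t where t: "U k f = scale_fun t f" ..
  have "T (U k f) = scale_fun t (scale_fun c f)"
    unfolding t T_scale using assms by (simp add: E_def)
  moreover have "U (Suc k) f x = T (U k f) x - of_nat (k * p) * U k f x" for x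
    by (simp add: T_U)
  ultimately have "U (Suc k) f = scale_fun (t * c - of_nat (k * p) * t) f"
    unfolding t by (simp add: fun_eq_iff scale_fun_def algebra_simps)
  then show ?case ..
qed

text \<open>\<open>P i f\<close> is a multiple of \<open>f\<close> and also satisfies the eigenvalue
  equation for \<open>i p\<close>; if it is nonzero, the two eigenvalues coincide.\<close>

lemma P_eigenvector:
  assumes "f \<in> E c"
  shows "\<exists>q. P i f = scale_fun q f \<and> (f \<noteq> 0 \<longrightarrow> q \<noteq> 0 \<longrightarrow> c = of_nat (i * p))"
proof -
  obtain t where t: "\<And>k. U k f = scale_fun (t k) f" using U_eigenvector[OF assms] by metis
  define q where "q = (\<Sum>k\<le>n. inversion_coeff p i k * t k)"
  have q: "P i f = scale_fun q f"
    by (simp add: P_def t q_def fun_eq_iff scale_fun_def sum_distrib_right mult.assoc)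
  have "scale_fun q (scale_fun c f) = scale_fun (of_nat (i * p)) (scale_fun q f)"
    using T_P[of i f] assms unfolding q T_scale by (simp add: E_def)
  then have "q \<noteq> 0 \<longrightarrow> c * f x = of_nat (i * p) * f x" for x
    by (auto simp: fun_eq_iff scale_fun_def dest!: spec[of _ x])
  then have "f \<noteq> 0 \<longrightarrow> q \<noteq> 0 \<longrightarrow> c = of_nat (i * p)"
    by (auto simp: fun_eq_iff)
  with q show ?thesis by blast
qed

lemma P_other_eigenvector:
  assumes "f \<in> E c" "c \<noteq> of_nat (i * p)"
  shows "P i f = 0"
proof -
  obtain q where q: "P i f = scale_fun q f" "f \<noteq> 0 \<longrightarrow> q \<noteq> 0 \<longrightarrow> c = of_nat (i * p)"
    using P_eigenvector[OF assms(1)] by blast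
  then have "f = 0 \<or> q = 0" using assms(2) by blast
  then show ?thesis using q(1) by (auto simp: scale_fun_def fun_eq_iff)
qed

text \<open>All other projections kill \<open>f\<close>, since \<open>p > 0\<close> makes their
  eigenvalues different from \<open>i p\<close>, and the projections add up to the identity on
  \<open>V\<close>.\<close>

lemma P_own_eigenvector:
  assumes "f \<in> E (of_nat (i * p))" "i \<le> n"
  shows "P i f = f"
proof
  fix x
  have "P j f x = (if j = i then P i f x else 0)" for j
    using P_other_eigenvector[OF assms(1), of j] p_pos by auto
  then have "(\<Sum>j\<le>n. P j f x) = (\<Sum>j\<le>n. if j = i then P i f x else 0)"
    by (rule sum.cong[OF refl])
  also have "\<dots> = P i f x" using assms(2) by simp
  finally show "P i f x = f x" using sum_P[of f x] assms(1) by (simp add: E_def)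
qed

text \<open>An eigenvector is the sum of its components \<open>P i f\<close>, so one of them is
  nonzero, which forces the eigenvalue \<open>i p\<close>.\<close>

lemma eigenvalues_subset: "eigenvalues V T \<subseteq> {of_nat (i * p) | i. i \<le> n}"
proof
  fix c assume "c \<in> eigenvalues V T"
  then obtain f where f: "f \<in> E c" "f \<noteq> 0" by (auto simp: eigenvalues_def E_def)
  then obtain x where "f x \<noteq> 0" by (auto simp: fun_eq_iff)
  moreover have "f \<in> V" using f(1) by (simp add: E_def)
  ultimately have "(\<Sum>i\<le>n. P i f x) \<noteq> 0" using sum_P[of f x] by simp
  then obtain i where "i \<le> n" "P i f x \<noteq> 0" by (meson sum.not_neutral_contains_not_neutral atMost_iff)
  then show "c \<in> {of_nat (i * p) | i. i \<le> n}"
    using P_other_eigenvector[OF f(1), of i] by fastforce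
qed

lemma geometric_multiplicity_eq:
  assumes "i \<le> n"
  shows "of_nat (geometric_multiplicity V T (of_nat (i * p)))
    = (\<Sum>k\<le>n. inversion_coeff p i k * (\<Sum>y\<in>A. R k y y))"
proof -
  have "of_nat (fun_space.dim (E (of_nat (i * p)))) = (\<Sum>y\<in>A. K i y y)"
  proof (rule dim_eq_trace[OF finite_A, where K = "K i"])
    \<comment> \<open>The column of \<open>K i\<close> at \<open>y\<close> is the image of the
      indicator function of \<open>y\<close> under \<open>P i\<close>.\<close>
    fix y assume "y \<in> A"
    then have "(\<lambda>x. K i x y) = P i (\<lambda>z. if z = y then 1 else 0)"
      unfolding P_eq_K using finite_A by (simp add: if_distrib cong: if_cong)
    then show "(\<lambda>x. K i x y) \<in> E (of_nat (i * p))" using P_in_E by simp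
  next
    fix f assume "f \<in> E (of_nat (i * p))"
    then show "(\<lambda>x. \<Sum>y\<in>A. K i x y * f y) = f"
      using P_own_eigenvector[of f i] assms unfolding P_eq_K by blast
  qed
  also have "\<dots> = (\<Sum>k\<le>n. inversion_coeff p i k * (\<Sum>y\<in>A. R k y y))"
    unfolding K_def sum_distrib_left by (rule sum.swap)
  finally show ?thesis by (simp add: geometric_multiplicity_def E_def)
qed

text \<open>On the component \<open>P i f\<close> the operator \<open>T - c\<close> is
  multiplication by \<open>i p - c\<close>.\<close>

lemma T_shift_funpow:
  assumes "f \<in> V"
  shows "((\<lambda>h. T h - scale_fun c h) ^^ r) f
    = (\<lambda>x. \<Sum>i\<le>n. (of_nat (i * p) - c) ^ r * P i f x)"
proof (induction r)
  case 0
  show ?case using sum_P[OF assms] by simp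
next
  case (Suc r)
  let ?g = "\<lambda>x. \<Sum>i\<le>n. (of_nat (i * p) - c) ^ r * P i f x"
  have "((\<lambda>h. T h - scale_fun c h) ^^ Suc r) f = T ?g - scale_fun c ?g"
    unfolding funpow.simps comp_apply Suc.IH ..
  also have "\<dots> = (\<lambda>x. \<Sum>i\<le>n. (of_nat (i * p) - c) ^ Suc r * P i f x)"
  proof
    fix x
    have "(T ?g - scale_fun c ?g) x
        = (\<Sum>i\<le>n. (of_nat (i * p) - c) ^ r * (of_nat (i * p) * P i f x)
            - c * ((of_nat (i * p) - c) ^ r * P i f x))"
      unfolding T_lincomb T_P by (simp add: scale_fun_def sum_distrib_left sum_subtractf)
    also have "\<dots> = (\<Sum>i\<le>n. (of_nat (i * p) - c) ^ Suc r * P i f x)"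
      by (rule sum.cong) (simp_all add: algebra_simps)
    finally show "(T ?g - scale_fun c ?g) x = (\<Sum>i\<le>n. (of_nat (i * p) - c) ^ Suc r * P i f x)" .
  qed
  finally show ?case .
qed

text \<open>Diagonalizability: applying \<open>P j\<close> to \<open>(T - c) ^ r f = 0\<close>
  isolates one component of \<open>f\<close>, on which \<open>T - c\<close> is a scalar.\<close>

lemma generalized_eigenspace:
  "{f \<in> V. \<exists>r. ((\<lambda>h. T h - scale_fun c h) ^^ r) f = 0} = E c"
proof (intro equalityI subsetI)
  fix f assume "f \<in> E c"
  then have "((\<lambda>h. T h - scale_fun c h) ^^ 1) f = 0" by (simp add: E_def)
  then show "f \<in> {f \<in> V. \<exists>r. ((\<lambda>h. T h - scale_fun c h) ^^ r) f = 0}"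
    using \<open>f \<in> E c\<close> unfolding E_def by blast
next
  fix f assume "f \<in> {f \<in> V. \<exists>r. ((\<lambda>h. T h - scale_fun c h) ^^ r) f = 0}"
  then obtain r where "f \<in> V" and r: "((\<lambda>h. T h - scale_fun c h) ^^ r) f = 0" by blast
  define g where "g = (\<lambda>x. \<Sum>i\<le>n. (of_nat (i * p) - c) ^ r * P i f x)"
  have "g = 0" using r T_shift_funpow[OF \<open>f \<in> V\<close>] by (simp add: g_def)
  have P_0: "(of_nat (j * p) - c) ^ r * P j f x = 0" if "j \<le> n" for j x
  proof -
    have PP: "P j (P i f) y = (if i = j then P j f y else 0)" for i y
      using P_own_eigenvector[OF P_in_E \<open>j \<le> n\<close>, of f] P_other_eigenvector[OF P_in_E, of i j f] p_pos
      by auto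
    have "P j g x = (\<Sum>i\<le>n. (of_nat (i * p) - c) ^ r * P j (P i f) x)"
      unfolding g_def P_lincomb ..
    also have "\<dots> = (\<Sum>i\<le>n. if i = j then (of_nat (j * p) - c) ^ r * P j f x else 0)"
      by (rule sum.cong) (simp_all add: PP)
    also have "\<dots> = (of_nat (j * p) - c) ^ r * P j f x" using \<open>j \<le> n\<close> by simp
    finally have "P j g x = (of_nat (j * p) - c) ^ r * P j f x" .
    moreover have "P j g x = 0" by (simp add: P_def U_def \<open>g = 0\<close>)
    ultimately show ?thesis by simp
  qed
  have "T f - scale_fun c f = ((\<lambda>h. T h - scale_fun c h) ^^ 1) f" by simp
  also have "\<dots> = (\<lambda>x. \<Sum>i\<le>n. (of_nat (i * p) - c) ^ 1 * P i f x)"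
    by (rule T_shift_funpow[OF \<open>f \<in> V\<close>])
  also have "\<dots> = 0"
  proof
    fix x
    \<comment> \<open>If a power of \<open>i p - c\<close> annihilates \<open>P i f x\<close>, then
      the first power does so too; for \<open>r = 0\<close> the component itself vanishes.\<close>
    have "(of_nat (i * p) - c) ^ 1 * P i f x = 0" if "i \<le> n" for i
      using P_0[OF that, of x] by auto
    then show "(\<Sum>i\<le>n. (of_nat (i * p) - c) ^ 1 * P i f x) = 0 x"
      unfolding zero_fun_apply by (intro sum.neutral ballI) (simp only: atMost_iff)
  qed
  finally have "T f - scale_fun c f = 0" .
  then show "f \<in> E c" using \<open>f \<in> V\<close> by (simp add: E_def)
qed

lemma algebraic_eq_geometric_multiplicity:
  "algebraic_multiplicity V T c = geometric_multiplicity V T c"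
  unfolding algebraic_multiplicity_def generalized_eigenspace geometric_multiplicity_def E_def ..

end

section \<open>The action of the top-to-random element\<close>

text \<open>The cycle whose word is \<open>2 3 ... m 1 (m + 1) ... n\<close>: the letter 1 inserted
  at position \<open>m\<close>. The value 0 is fixed so that the map is the identity outside
  \<open>{1..n}\<close>; \<open>lower\<close> is its inverse.\<close>

definition raise :: "nat \<Rightarrow> nat \<Rightarrow> nat" where
  "raise m v = (if v = 0 \<or> m < v then v else if v = m then 1 else Suc v)"

definition lower :: "nat \<Rightarrow> nat \<Rightarrow> nat" where
  "lower m v = (if v = 1 then m else if v \<le> m then v - 1 else v)"

lemma raise_lower: "m > 0 \<Longrightarrow> raise m (lower m v) = v"
  by (auto simp: raise_def lower_def)

lemma lower_raise: "m > 0 \<Longrightarrow> lower m (raise m v) = v"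
  by (auto simp: raise_def lower_def)

lemma raise_permutes:
  assumes "m \<in> {1..n}"
  shows "raise m permutes {1..n}"
  unfolding permutes_def
proof (intro conjI allI impI)
  show "\<exists>!x. raise m x = y" for y
    using assms by (intro ex1I[of _ "lower m y"]) (auto simp: raise_lower lower_raise)
qed (use assms in \<open>auto simp: raise_def\<close>)

lemma lower_permutes:
  assumes "m \<in> {1..n}"
  shows "lower m permutes {1..n}"
  unfolding permutes_def
proof (intro conjI allI impI)
  show "\<exists>!x. lower m x = y" for y
    using assms by (intro ex1I[of _ "raise m y"]) (auto simp: raise_lower lower_raise)
qed (use assms in \<open>auto simp: lower_def\<close>)

text \<open>The group elements occurring in \<open>B1\<close>: the top card, recolored to
  \<open>j\<close>, moved to position \<open>m\<close>.\<close>

definition insertion :: "nat \<Rightarrow> nat \<Rightarrow> int \<Rightarrow> colored_perm" where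
  "insertion n m j = (\<lambda>i\<in>{1..n}. if i = m then j else 0, raise m)"

text \<open>Left multiplication by the inverse of \<open>insertion n m j\<close>, see \<open>uninsert_eq\<close>.\<close>

definition uninsert :: "nat \<Rightarrow> nat \<Rightarrow> nat \<Rightarrow> int \<Rightarrow> colored_perm \<Rightarrow> colored_perm" where
  "uninsert n p m j = (\<lambda>(s, \<sigma>).
     (\<lambda>a\<in>{1..n}. if \<sigma> a = 1 then (s a - j) mod int p else s a, lower m \<circ> \<sigma>))"

section \<open>Explicit arithmetic in the colored permutation group\<close>

lemma carrier_colored_perm_group:
  assumes "p > 0"
  shows "carrier (colored_perm_group n p)
    = ({1..n} \<rightarrow>\<^sub>E {0..<int p}) \<times> {\<sigma>. \<sigma> permutes {1..n}}"
  using assms by (simp add: colored_perm_group_def carrier_integer_mod_group)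

lemma mult_colored_perm_group:
  "(t, \<tau>) \<otimes>\<^bsub>colored_perm_group n p\<^esub> (s, \<sigma>)
    = (\<lambda>i\<in>{1..n}. (t (\<sigma> i) + s i) mod int p, \<tau> \<circ> \<sigma>)"
  by (simp add: colored_perm_group_def)

lemma one_colored_perm_group:
  "\<one>\<^bsub>colored_perm_group n p\<^esub> = (\<lambda>i\<in>{1..n}. 0, id)"
  by (simp add: colored_perm_group_def)

lemma finite_colored_perm_group: "p > 0 \<Longrightarrow> finite (carrier (colored_perm_group n p))"
  by (simp add: carrier_colored_perm_group finite_PiE finite_permutations)

lemma insertion_closed:
  "m \<in> {1..n} \<Longrightarrow> j \<in> {0..<int p} \<Longrightarrow> insertion n m j \<in> carrier (colored_perm_group n p)"
  using raise_permutes[of m n]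
  by (subst carrier_colored_perm_group) (auto simp: insertion_def)

lemma uninsert_closed:
  assumes "p > 0" "m \<in> {1..n}" "x \<in> carrier (colored_perm_group n p)"
  shows "uninsert n p m j x \<in> carrier (colored_perm_group n p)"
  using assms lower_permutes[of m n]
  by (auto simp: uninsert_def carrier_colored_perm_group intro!: permutes_compose split: if_splits)

lemma insertion_uninsert:
  assumes "m \<in> {1..n}" "j \<in> {0..<int p}" "x \<in> carrier (colored_perm_group n p)"
  shows "insertion n m j \<otimes>\<^bsub>colored_perm_group n p\<^esub> uninsert n p m j x = x"
proof -
  have "p > 0" "m > 0" using assms by auto
  obtain s \<sigma> where x: "x = (s, \<sigma>)" by (cases x)
  with assms \<open>p > 0\<close> have s: "s \<in> {1..n} \<rightarrow>\<^sub>E {0..<int p}" and \<sigma>: "\<sigma> permutes {1..n}"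
    by (auto simp: carrier_colored_perm_group)
  define s' where "s' = (\<lambda>a\<in>{1..n}. if \<sigma> a = 1 then (s a - j) mod int p else s a)"
  define t where "t = (\<lambda>i\<in>{1..n}. if i = m then j else 0)"
  have "(t (lower m (\<sigma> i)) + s' i) mod int p = s i" if i: "i \<in> {1..n}" for i
  proof -
    have "s i \<in> {0..<int p}" using s i by blast
    moreover have "\<sigma> i \<in> {1..n}" using permutes_in_image[OF \<sigma>] i by blast
    moreover from this have "lower m (\<sigma> i) \<in> {1..n}"
      using permutes_in_image[OF lower_permutes[OF assms(1)]] by blast
    \<comment> \<open>The product adds \<open>j\<close> exactly at the place carrying the letter 1,
      from which \<open>uninsert\<close> has subtracted it.\<close>
    moreover have "lower m (\<sigma> i) = m \<longleftrightarrow> \<sigma> i = 1"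
      using \<open>\<sigma> i \<in> {1..n}\<close> by (auto simp: lower_def)
    ultimately show ?thesis using i by (auto simp: s'_def t_def mod_simps)
  qed
  then have "(\<lambda>i\<in>{1..n}. (t ((lower m \<circ> \<sigma>) i) + s' i) mod int p) = s"
    using s by (auto simp: fun_eq_iff PiE_def extensional_def)
  moreover have "raise m \<circ> (lower m \<circ> \<sigma>) = \<sigma>"
    using raise_lower[OF \<open>m > 0\<close>] by (simp add: fun_eq_iff)
  ultimately show ?thesis
    unfolding x insertion_def uninsert_def case_prod_conv mult_colored_perm_group
    by (simp add: s'_def t_def)
qed

lemma uninsert_eq:
  assumes "m \<in> {1..n}" "j \<in> {0..<int p}" "x \<in> carrier (colored_perm_group n p)"
  shows "uninsert n p m j x
    = inv\<^bsub>colored_perm_group n p\<^esub> (insertion n m j) \<otimes>\<^bsub>colored_perm_group n p\<^esub> x"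
proof -
  interpret G: group "colored_perm_group n p" by (rule group_colored_perm_group)
  have "p > 0" using assms(2) by auto
  show ?thesis
    by (subst G.inv_solve_left)
      (simp_all add: insertion_uninsert[OF assms] insertion_closed[OF assms(1,2)]
        uninsert_closed[OF \<open>p > 0\<close> assms(1,3)] assms(3))
qed

section \<open>Words of insertions and the coefficients of the top-to-random element\<close>

lemma shuffle_product_single:
  "shuffle_product [a] v = image_mset (\<lambda>m. take m v @ a # drop m v) (mset [0..<Suc (length v)])"
proof (induction v)
  case (Cons b v)
  \<comment> \<open>Cut 0 puts the new letter before \<open>b\<close>; the remaining cuts are those
    of \<open>v\<close>, shifted by one.\<close>
  have "[0..<Suc (length (b # v))] = 0 # map Suc [0..<Suc (length v)]"
    unfolding map_Suc_upt by (simp only: length_Cons upt_conv_Cons[OF zero_less_Suc])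
  then show ?case
    by (simp del: upt_Suc add: Cons.IH image_mset.compositionality comp_def)
qed simp

lemma word_of_insertion:
  assumes "m \<in> {1..n}"
  shows "word_of n (insertion n m j) = take (m - 1) (W 1 n) @ (j, 1) # drop (m - 1) (W 1 n)"
proof (rule nth_equalityI)
  show "length (word_of n (insertion n m j)) = length (take (m - 1) (W 1 n) @ (j, 1) # drop (m - 1) (W 1 n))"
    using assms by (auto simp: word_of_def insertion_def W_def min_def simp del: upt_Suc)
next
  fix i assume "i < length (word_of n (insertion n m j))"
  then have "i < n" by (simp add: word_of_def insertion_def del: upt_Suc)
  then have lhs: "word_of n (insertion n m j) ! i = (if Suc i = m then j else 0, raise m (Suc i))"
    by (auto simp: word_of_def insertion_def simp del: upt_Suc)
  have W_nth: "W (Suc 0) n ! l = (0, Suc (Suc l))" if "l < n - 1" for l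
    using that by (simp add: W_def del: upt_Suc)
  have W_length: "length (W (Suc 0) n) = n - 1"
    by (simp add: W_def del: upt_Suc)
  consider "Suc i < m" | "Suc i = m" | "m < Suc i" by linarith
  then show "word_of n (insertion n m j) ! i = (take (m - 1) (W 1 n) @ (j, 1) # drop (m - 1) (W 1 n)) ! i"
  proof cases
    case 1
    then have "i < m - 1" by simp
    then show ?thesis using 1 assms unfolding lhs by (simp add: nth_append W_length W_nth raise_def)
  next
    case 2
    moreover have "length (take i (W 1 n)) = i" using \<open>i < n\<close> by (simp add: W_length)
    ultimately show ?thesis unfolding lhs by (auto simp: nth_append raise_def)
  next
    case 3
    then have "m - 1 + (i - (m - 1) - 1) = i - 1" "i - 1 < n - 1" "Suc (i - 1) = i" "\<not> i < m - 1"
      using assms \<open>i < n\<close> by auto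
    then show ?thesis using assms 3 unfolding lhs
      by (simp add: nth_append W_length W_nth raise_def nth_Cons')
  qed
qed

text \<open>Words see only the values on \<open>{1..n}\<close>; extensional colorings and
  permutations that are the identity elsewhere are determined by them.\<close>

lemma word_of_inj: "inj_on (word_of n) (carrier (colored_perm_group n p))"
proof (rule inj_onI)
  fix x y assume xy: "x \<in> carrier (colored_perm_group n p)" "y \<in> carrier (colored_perm_group n p)"
    and eq: "word_of n x = word_of n y"
  obtain s \<sigma> t \<tau> where [simp]: "x = (s, \<sigma>)" "y = (t, \<tau>)" by (cases x, cases y)
  have *: "s i = t i \<and> \<sigma> i = \<tau> i" if "i \<in> {1..n}" for i
    using eq that by (auto simp: word_of_def simp del: upt_Suc)
  have "s = t" using xy * by (intro PiE_ext[of s "{1..n}" _ t]) (auto simp: colored_perm_group_def)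
  moreover have "\<sigma> i = \<tau> i" for i
  proof (cases "i \<in> {1..n}")
    case False
    have "\<sigma> permutes {1..n}" "\<tau> permutes {1..n}" using xy by (simp_all add: colored_perm_group_def)
    then show ?thesis using permutes_not_in[OF _ False] by metis
  qed (use * in blast)
  ultimately show "x = y" by auto
qed

lemma bij_betw_colored_perm_group_1:
  assumes "p > 0"
  shows "bij_betw (\<lambda>j. (\<lambda>i\<in>{1..1}. j, id)) {0..<int p} (carrier (colored_perm_group 1 p))"
proof (rule bij_betwI')
  fix j k :: int
  show "((\<lambda>i\<in>{1..1::nat}. j, id) = (\<lambda>i\<in>{1..1}. k, id :: nat \<Rightarrow> nat)) \<longleftrightarrow> j = k"
    by (auto dest: fun_cong[where x = 1])
  show "(\<lambda>i\<in>{1..1}. j, id) \<in> carrier (colored_perm_group 1 p)" if "j \<in> {0..<int p}"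
    using that assms by (simp add: carrier_colored_perm_group permutes_id)
next
  fix x assume "x \<in> carrier (colored_perm_group 1 p)"
  then obtain s \<sigma> where x: "x = (s, \<sigma>)" "s \<in> {1} \<rightarrow>\<^sub>E {0..<int p}" "\<sigma> permutes {1}"
    using assms by (auto simp: carrier_colored_perm_group)
  have "\<sigma> = id" using x(3) by simp
  moreover have "s 1 \<in> {0..<int p}" using x(2) by blast
  moreover have "s = (\<lambda>i\<in>{1..1}. s 1)" using x(2) by (auto simp: fun_eq_iff PiE_def extensional_def)
  ultimately show "\<exists>j\<in>{0..<int p}. x = (\<lambda>i\<in>{1..1}. j, id)" using x(1) by metis
qed

text \<open>Each one-letter word \<open>(j, 1)\<close> has \<open>n\<close> interleavings with
  \<open>W 1 n\<close>, and injectivity of \<open>word_of\<close> turns equality of words into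
  equality of group elements. List cuts count from 0, positions \<open>m\<close> from 1.\<close>

lemma B1_eq:
  assumes "p > 0" "n > 0" "g \<in> carrier (colored_perm_group n p)"
  shows "B1 n p g = (\<Sum>j\<in>{0..<int p}. \<Sum>m\<in>{1..n}. if insertion n m j = g then 1 else 0)"
proof -
  let ?e = "\<lambda>j. (\<lambda>i\<in>{1..1::nat}. j, id :: nat \<Rightarrow> nat)"
  note bij = bij_betw_colored_perm_group_1[OF \<open>p > 0\<close>]
  have count: "of_nat (count (shuffle_product (word_of 1 (?e j)) (W 1 n)) (word_of n g))
      = (\<Sum>m\<in>{1..n}. if insertion n m j = g then 1 else (0::rat))" if "j \<in> {0..<int p}" for j
  proof -
    have "length (W 1 n) = n - 1" by (simp add: W_def del: upt_Suc)
    then have upt: "[0..<Suc (length (W 1 n))] = [0..<n]" using \<open>n > 0\<close> by (simp del: upt_Suc)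
    have "word_of 1 (?e j) = [(j, 1)]" by (simp add: word_of_def)
    then have "shuffle_product (word_of 1 (?e j)) (W 1 n)
        = image_mset (\<lambda>m. take m (W 1 n) @ (j, 1) # drop m (W 1 n)) (mset_set {0..<n})"
      by (simp only: shuffle_product_single upt mset_upt)
    also have "\<dots> = image_mset (\<lambda>m. word_of n (insertion n (Suc m) j)) (mset_set {0..<n})"
      by (intro image_mset_cong) (simp add: word_of_insertion)
    also have "count \<dots> (word_of n g) = card {m \<in> {0..<n}. insertion n (Suc m) j = g}"
    proof -
      have "word_of n (insertion n (Suc m) j) = word_of n g \<longleftrightarrow> insertion n (Suc m) j = g" if "m < n" for m
        using that insertion_closed[of "Suc m" n j p] \<open>j \<in> _\<close> assms(3) word_of_inj[of n p]
        by (auto simp: inj_on_eq_iff)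
      then show ?thesis
        by (auto simp: count_image_mset' eq_commute[of "word_of n g"] intro!: arg_cong[where f = card])
    qed
    also have "of_nat \<dots> = (\<Sum>m\<in>{0..<n}. if insertion n (Suc m) j = g then 1 else (0::rat))"
      by (simp add: sum.If_cases Int_def)
    also have "\<dots> = (\<Sum>m\<in>{1..n}. if insertion n m j = g then 1 else 0)"
      by (rule sum.reindex_bij_witness[where i = "\<lambda>m. m - 1" and j = Suc]) auto
    finally show ?thesis .
  qed
  show ?thesis
    unfolding B1_def sum.reindex_bij_betw[OF bij, symmetric] using count by (rule sum.cong[OF refl])
qed

lemma left_regular_algebra_B1:
  assumes "p > 0" "n > 0"
  shows "left_regular_algebra (colored_perm_group n p) (B1 n p) f x
    = (if x \<in> carrier (colored_perm_group n p)
       then \<Sum>j\<in>{0..<int p}. \<Sum>m\<in>{1..n}. f (uninsert n p m j x) else 0)"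
proof -
  let ?G = "colored_perm_group n p"
  have "left_regular_algebra ?G (B1 n p) f x
      = (\<Sum>g\<in>carrier ?G. \<Sum>j\<in>{0..<int p}. \<Sum>m\<in>{1..n}.
          if insertion n m j = g then left_regular ?G g f x else 0)"
    unfolding left_regular_algebra_def
    by (rule sum.cong)
      (simp_all add: B1_eq[OF assms] of_rat_sum sum_distrib_right if_distrib[of of_rat] if_distrib[of "\<lambda>u. u * _"]
        cong: if_cong)
  also have "\<dots> = (\<Sum>j\<in>{0..<int p}. \<Sum>m\<in>{1..n}. \<Sum>g\<in>carrier ?G.
          if insertion n m j = g then left_regular ?G g f x else 0)"
    by (subst sum.swap, subst (2) sum.swap) (rule refl)
  also have "\<dots> = (\<Sum>j\<in>{0..<int p}. \<Sum>m\<in>{1..n}. left_regular ?G (insertion n m j) f x)"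
    using finite_colored_perm_group[OF \<open>p > 0\<close>] insertion_closed
    by (intro sum.cong refl) simp
  also have "\<dots> = (if x \<in> carrier ?G
       then \<Sum>j\<in>{0..<int p}. \<Sum>m\<in>{1..n}. f (uninsert n p m j x) else 0)"
    by (simp add: left_regular_def uninsert_eq)
  finally show ?thesis .
qed

section \<open>Products with the top-to-random element\<close>

text \<open>
  For \<open>k \<le> n\<close>: the word of \<open>(s, \<sigma>)\<close> occurs in \<open>\<alpha> \<squnion>\<squnion> W k n\<close> for some word \<open>\<alpha>\<close> of the group on \<open>k\<close> letters.
\<close>

definition increasing_above :: "nat \<Rightarrow> nat \<Rightarrow> colored_perm \<Rightarrow> bool" where
  "increasing_above n k = (\<lambda>(s, \<sigma>). \<forall>a\<in>{1..n}. k < \<sigma> a \<longrightarrow>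
     s a = 0 \<and> (\<forall>b\<in>{1..n}. \<sigma> a < \<sigma> b \<longrightarrow> a < b))"

text \<open>All letters exceed 0, so all colors vanish and the permutation is increasing.\<close>

lemma increasing_above_0:
  assumes "x \<in> carrier (colored_perm_group n p)"
  shows "increasing_above n 0 x \<longleftrightarrow> x = \<one>\<^bsub>colored_perm_group n p\<^esub>"
proof
  assume inc: "increasing_above n 0 x"
  obtain s \<sigma> where x: "x = (s, \<sigma>)" by (cases x)
  have s: "s \<in> extensional {1..n}" and \<sigma>: "\<sigma> permutes {1..n}"
    using assms by (auto simp: x colored_perm_group_def PiE_def)
  have pos: "0 < \<sigma> a" if "a \<in> {1..n}" for a
    using permutes_in_image[OF \<sigma>, of a] that by auto
  have "s = (\<lambda>i\<in>{1..n}. 0)"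
    using inc pos s by (auto simp: x increasing_above_def fun_eq_iff extensional_def)
  \<comment> \<open>A finite set of numbers has only one increasing enumeration.\<close>
  moreover have "map \<sigma> [1..<Suc n] = [1..<Suc n]"
  proof (rule sorted_distinct_set_unique)
    show "sorted (map \<sigma> [1..<Suc n])"
    proof (rule sorted_wrt_mono_rel[THEN sorted_wrt_map[THEN iffD2]])
      show "sorted_wrt (<) [1..<Suc n]" by (simp del: upt_Suc)
      fix a b assume ab: "a \<in> set [1..<Suc n]" "b \<in> set [1..<Suc n]" "a < b"
      then have "a \<in> {1..n}" "b \<in> {1..n}" by (simp_all del: upt_Suc)
      then have "b < a" if "\<sigma> b < \<sigma> a"
        using inc pos that unfolding x increasing_above_def case_prod_conv by blast
      then have "\<not> \<sigma> b < \<sigma> a" using ab(3) by auto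
      then show "\<sigma> a \<le> \<sigma> b" by simp
    qed
    show "distinct (map \<sigma> [1..<Suc n])"
      using permutes_inj[OF \<sigma>] by (simp add: distinct_map inj_on_def inj_def del: upt_Suc)
    have "\<sigma> ` {1..<Suc n} = {1..<Suc n}"
      using permutes_image[OF \<sigma>] by (simp add: atLeastLessThanSuc_atLeastAtMost)
    then show "set (map \<sigma> [1..<Suc n]) = set [1..<Suc n]" by (simp del: upt_Suc)
  qed (simp_all del: upt_Suc)
  then have "\<sigma> a = a" if "a \<in> {1..n}" for a
    using that map_eq_conv[of \<sigma> "[1..<Suc n]" "\<lambda>a. a"] by (simp del: upt_Suc)
  then have "\<sigma> = id"
    using permutes_not_in[OF \<sigma>] by (metis eq_id_iff)
  ultimately show "x = \<one>\<^bsub>colored_perm_group n p\<^esub>" by (simp add: x one_colored_perm_group)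
qed (auto simp: one_colored_perm_group increasing_above_def)

lemma increasing_above_one: "increasing_above n k \<one>\<^bsub>colored_perm_group n p\<^esub>"
  by (auto simp: one_colored_perm_group increasing_above_def)

lemma increasing_above_full:
  assumes "x \<in> carrier (colored_perm_group n p)" "n \<le> k"
  shows "increasing_above n k x"
proof -
  obtain s \<sigma> where x: "x = (s, \<sigma>)" by (cases x)
  have \<sigma>: "\<sigma> permutes {1..n}" using assms by (auto simp: x colored_perm_group_def)
  have "\<sigma> a \<le> n" if "a \<in> {1..n}" for a
    using permutes_in_image[OF \<sigma>, of a] that by auto
  then show ?thesis using assms(2) by (force simp: x increasing_above_def)
qed

text \<open>\<open>lower m\<close> permutes the letters \<open>1..m\<close> among themselves and
  only the letter 1 is recolored; none of these lies above \<open>k\<close>.\<close>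

lemma increasing_above_uninsert_low:
  assumes "m \<le> k" "0 < m"
  shows "increasing_above n k (uninsert n p m j x) \<longleftrightarrow> increasing_above n k x"
proof -
  obtain s \<sigma> where x: "x = (s, \<sigma>)" by (cases x)
  have low: "k < lower m v \<longleftrightarrow> k < v" for v using assms by (auto simp: lower_def)
  have high: "lower m v = v" if "k < v" for v using assms that by (auto simp: lower_def)
  have less: "v < lower m w \<longleftrightarrow> v < w" if "k < v" for v w
    using assms that by (auto simp: lower_def)
  show ?thesis
    unfolding x uninsert_def increasing_above_def case_prod_conv
    using assms by (intro ball_cong refl imp_cong) (auto simp: low high less)
qed

text \<open>Afterwards the letters above \<open>k\<close> are the former letters above
  \<open>k + 1\<close>, in the same relative order, and the former letter 1, which has become
  \<open>m\<close>. The latter needs color 0, and its place \<open>c\<close> must separate the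
  letters up to \<open>m\<close> from the larger ones.\<close>

lemma increasing_above_uninsert_high:
  assumes x: "(s, \<sigma>) \<in> carrier (colored_perm_group n p)" and "j \<in> {0..<int p}"
    and "k < m" "m \<le> n" and c: "c \<in> {1..n}" "\<sigma> c = 1"
  shows "increasing_above n k (uninsert n p m j (s, \<sigma>)) \<longleftrightarrow>
    increasing_above n (Suc k) (s, \<sigma>) \<and> j = s c \<and>
    (\<forall>a\<in>{1..n}. Suc k < \<sigma> a \<longrightarrow> (if \<sigma> a \<le> m then a < c else c < a))"
    (is "?L \<longleftrightarrow> ?R")
proof -
  have "p > 0" using assms(2) by auto
  then have s: "s \<in> {1..n} \<rightarrow>\<^sub>E {0..<int p}" and \<sigma>: "\<sigma> permutes {1..n}"
    using x by (auto simp: carrier_colored_perm_group)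
  have inj: "a = c" if "\<sigma> a = 1" for a using permutes_inj[OF \<sigma>] that c(2) by (metis injD)
  have pos: "\<sigma> a \<noteq> 0" if "a \<in> {1..n}" for a
    using permutes_in_image[OF \<sigma>, of a] that by auto
  have "s c \<in> {0..<int p}" using s c(1) by blast
  then have color: "(s c - j) mod int p = 0 \<longleftrightarrow> j = s c"
    using \<open>j \<in> _\<close> by (auto simp: mod_eq_0_iff_dvd simp flip: mod_eq_dvd_iff)
  have unfold: "?L \<longleftrightarrow> (\<forall>a\<in>{1..n}. k < lower m (\<sigma> a) \<longrightarrow>
      (if \<sigma> a = 1 then j = s c else s a = 0) \<and>
      (\<forall>b\<in>{1..n}. lower m (\<sigma> a) < lower m (\<sigma> b) \<longrightarrow> a < b))"
    unfolding uninsert_def increasing_above_def case_prod_conv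
    using inj color by (intro ball_cong refl imp_cong) auto
  show ?thesis
  proof
    assume ?L
    then have L: "(if \<sigma> a = 1 then j = s c else s a = 0)"
        "\<And>b. b \<in> {1..n} \<Longrightarrow> lower m (\<sigma> a) < lower m (\<sigma> b) \<Longrightarrow> a < b"
      if "a \<in> {1..n}" "k < lower m (\<sigma> a)" for a
      using that unfolding unfold by blast+
    have "k < lower m (\<sigma> c)" using c \<open>k < m\<close> by (simp add: lower_def)
    note Lc = L[OF c(1) this]
    have up: "k < lower m (\<sigma> a)" "\<sigma> a \<noteq> 1" if "Suc k < \<sigma> a" for a
      using that by (auto simp: lower_def)
    have mono: "lower m (\<sigma> a) < lower m (\<sigma> b)" if "Suc k < \<sigma> a" "\<sigma> a < \<sigma> b" for a b
      using that by (auto simp: lower_def)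
    have "increasing_above n (Suc k) (s, \<sigma>)"
      unfolding increasing_above_def case_prod_conv using L up mono by meson
    moreover have "j = s c" using Lc(1) c(2) by simp
    moreover have "if \<sigma> a \<le> m then a < c else c < a" if a: "a \<in> {1..n}" "Suc k < \<sigma> a" for a
    proof (cases "\<sigma> a \<le> m")
      case True
      then have "lower m (\<sigma> a) < lower m (\<sigma> c)" using a(2) c(2) by (auto simp: lower_def)
      then show ?thesis using True L(2)[OF a(1) up(1)[OF a(2)] c(1)] by simp
    next
      case False
      then have "lower m (\<sigma> c) < lower m (\<sigma> a)" using a(2) c(2) by (auto simp: lower_def)
      then show ?thesis using False Lc(2)[OF a(1)] by simp
    qed
    ultimately show ?R by blast
  next
    assume ?R
    then have inc: "\<And>a. a \<in> {1..n} \<Longrightarrow> Suc k < \<sigma> a \<Longrightarrow> s a = 0"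
        "\<And>a b. a \<in> {1..n} \<Longrightarrow> Suc k < \<sigma> a \<Longrightarrow> b \<in> {1..n} \<Longrightarrow> \<sigma> a < \<sigma> b \<Longrightarrow> a < b"
      and "j = s c"
      and split: "\<And>a. a \<in> {1..n} \<Longrightarrow> Suc k < \<sigma> a \<Longrightarrow> if \<sigma> a \<le> m then a < c else c < a"
      unfolding increasing_above_def by blast+
    show ?L unfolding unfold
    proof (intro ballI impI conjI)
      fix a assume a: "a \<in> {1..n}" "k < lower m (\<sigma> a)"
      \<comment> \<open>A letter other than 1 that lies above \<open>k\<close> after lowering was
        above \<open>k + 1\<close> before, since \<open>m > k\<close>.\<close>
      then have a': "Suc k < \<sigma> a" if "\<sigma> a \<noteq> 1"
        using that pos[OF a(1)] \<open>k < m\<close> by (auto simp: lower_def split: if_splits)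
      show "if \<sigma> a = 1 then j = s c else s a = 0" using a' inc(1)[OF a(1)] \<open>j = s c\<close> by simp
      fix b assume b: "b \<in> {1..n}" "lower m (\<sigma> a) < lower m (\<sigma> b)"
      have b': "Suc k < \<sigma> b" if "\<sigma> b \<noteq> 1"
        using that pos[OF b(1)] \<open>k < m\<close> a(2) b(2) by (auto simp: lower_def split: if_splits)
      show "a < b"
      proof (cases "\<sigma> a = 1")
        case True
        then have "\<sigma> b \<noteq> 1" "\<not> \<sigma> b \<le> m" using b(2) by (auto simp: lower_def split: if_splits)
        then show ?thesis using split[OF b(1) b'] inj[OF True] by simp
      next
        case False
        note a'' = a'[OF False]
        show ?thesis
        proof (cases "\<sigma> b = 1")
          case True
          then have "\<sigma> a \<le> m" using b(2) False by (auto simp: lower_def split: if_splits)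
          then show ?thesis using split[OF a(1) a''] inj[OF True] by simp
        next
          case False
          have "\<sigma> a < \<sigma> b" using b(2) \<open>\<sigma> a \<noteq> 1\<close> False by (auto simp: lower_def split: if_splits)
          then show ?thesis using inc(2) a(1) a'' b(1) by blast
        qed
      qed
    qed
  qed
qed

text \<open>The letters above \<open>k + 1\<close> appear in increasing order, so those left of
  \<open>c\<close> are \<open>k + 2, ..., m\<close> for a single \<open>m\<close>.\<close>

lemma insertion_slot_unique:
  assumes x: "(s, \<sigma>) \<in> carrier (colored_perm_group n p)" and "k < n"
    and inc: "increasing_above n (Suc k) (s, \<sigma>)" and c: "c \<in> {1..n}" "\<sigma> c = 1"
  shows "\<exists>!m. m \<in> {k<..n} \<and>
    (\<forall>a\<in>{1..n}. Suc k < \<sigma> a \<longrightarrow> (if \<sigma> a \<le> m then a < c else c < a))"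
proof (rule ex_ex1I)
  have \<sigma>: "\<sigma> permutes {1..n}" using x by (auto simp: colored_perm_group_def)
  \<comment> \<open>\<open>Suc k\<close> is the slot when no letter above \<open>k + 1\<close>
    stands left of \<open>c\<close>.\<close>
  let ?M = "insert (Suc k) {\<sigma> a | a. a \<in> {1..n} \<and> Suc k < \<sigma> a \<and> a < c}"
  define m where "m = Max ?M"
  have fin: "finite ?M" by simp
  have m_in: "m \<in> ?M" unfolding m_def by (rule Max_in[OF fin]) simp
  have m_ge: "v \<le> m" if "v \<in> ?M" for v unfolding m_def using Max_ge[OF fin that] .
  have "m \<in> {k<..n}"
    using m_in \<open>k < n\<close> permutes_in_image[OF \<sigma>] by fastforce
  moreover have "if \<sigma> a \<le> m then a < c else c < a" if a: "a \<in> {1..n}" "Suc k < \<sigma> a" for a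
  proof (cases "\<sigma> a \<le> m")
    case True
    then obtain b where b: "m = \<sigma> b" "b \<in> {1..n}" "b < c" using m_in a(2) by auto
    have "a \<le> b"
    proof (cases "\<sigma> a = \<sigma> b")
      case True
      then show ?thesis using permutes_inj[OF \<sigma>] by (metis injD order_refl)
    next
      case False
      then have "\<sigma> a < \<sigma> b" using True b(1) by simp
      then show ?thesis using inc a b(2) by (force simp: increasing_above_def)
    qed
    then show ?thesis using True b(3) by simp
  next
    case False
    then have "\<not> a < c" using m_ge[of "\<sigma> a"] a by auto
    moreover have "a \<noteq> c" using a(2) c(2) by auto
    ultimately show ?thesis using False by simp
  qed
  ultimately show "\<exists>m. m \<in> {k<..n} \<and>
      (\<forall>a\<in>{1..n}. Suc k < \<sigma> a \<longrightarrow> (if \<sigma> a \<le> m then a < c else c < a))" by blast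
next
  have \<sigma>: "\<sigma> permutes {1..n}" using x by (auto simp: colored_perm_group_def)
  have le: "m' \<le> m" if m: "m \<in> {k<..n}" "m' \<in> {k<..n}"
    and "\<forall>a\<in>{1..n}. Suc k < \<sigma> a \<longrightarrow> (if \<sigma> a \<le> m then a < c else c < a)"
    and "\<forall>a\<in>{1..n}. Suc k < \<sigma> a \<longrightarrow> (if \<sigma> a \<le> m' then a < c else c < a)" for m m'
  proof (rule ccontr)
    assume "\<not> m' \<le> m"
    have "m' \<in> {1..n}" using m by auto
    \<comment> \<open>For \<open>m < m'\<close> the letter \<open>m'\<close> would have to stand
      left of \<open>c\<close> by the second condition and right of \<open>c\<close> by the
      first.\<close>
    then obtain a where a: "a \<in> {1..n}" "\<sigma> a = m'" using permutes_image[OF \<sigma>] by (metis imageE)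
    moreover have "Suc k < m'" using m \<open>\<not> m' \<le> m\<close> by auto
    ultimately show False using that(3,4) \<open>\<not> m' \<le> m\<close> by (metis less_asym order_refl)
  qed
  fix m m'
  assume "m \<in> {k<..n} \<and> (\<forall>a\<in>{1..n}. Suc k < \<sigma> a \<longrightarrow> (if \<sigma> a \<le> m then a < c else c < a))"
    and "m' \<in> {k<..n} \<and> (\<forall>a\<in>{1..n}. Suc k < \<sigma> a \<longrightarrow> (if \<sigma> a \<le> m' then a < c else c < a))"
  then show "m = m'" using le[of m m'] le[of m' m] by (intro order_antisym) blast+
qed

text \<open>The coefficients are 0 or 1, as the letters of a group word are distinct. Every group
  element satisfies \<open>increasing_above n k\<close> once \<open>n \<le> k\<close>; the conjunct
  \<open>k \<le> n\<close> makes the sequence stop after \<open>B n n\<close>.\<close>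

definition B :: "nat \<Rightarrow> nat \<Rightarrow> colored_perm \<Rightarrow> complex" where
  "B n k h = (if k \<le> n \<and> increasing_above n k h then 1 else 0)"

text \<open>
  The identity \<open>B\<^sub>1 B\<^sub>k = k p B\<^sub>k + B\<^sub>k\<^sub>+\<^sub>1\<close>. If \<open>m \<le> k\<close>, then \<open>uninsert\<close>
  does not touch the letters above \<open>k\<close>; for \<open>m > k\<close> exactly one slot and one color fit when the letters above
  \<open>k + 1\<close> are in order.
\<close>

lemma sum_B_uninsert:
  assumes "p > 0" "n > 0" and h: "h \<in> carrier (colored_perm_group n p)"
  shows "(\<Sum>j\<in>{0..<int p}. \<Sum>m\<in>{1..n}. B n k (uninsert n p m j h))
    = of_nat (k * p) * B n k h + B n (Suc k) h"
proof (cases "k \<le> n")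
  case False
  then show ?thesis by (simp add: B_def)
next
  case True
  have low: "(\<Sum>j\<in>{0..<int p}. \<Sum>m\<in>{1..k}. B n k (uninsert n p m j h)) = of_nat (k * p) * B n k h"
    by (simp add: B_def increasing_above_uninsert_low)
  \<comment> \<open>For \<open>k = n\<close> the range of \<open>m\<close> is empty and
    \<open>B n (Suc n)\<close> is 0.\<close>
  have high: "(\<Sum>j\<in>{0..<int p}. \<Sum>m\<in>{k<..n}. B n k (uninsert n p m j h)) = B n (Suc k) h"
  proof (cases "k < n")
    case False
    then show ?thesis using True by (simp add: B_def)
  next
    case True
    obtain s \<sigma> where hs: "h = (s, \<sigma>)" by (cases h)
    note x = h[unfolded hs]
    have s: "s \<in> {1..n} \<rightarrow>\<^sub>E {0..<int p}" and \<sigma>: "\<sigma> permutes {1..n}"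
      using x \<open>p > 0\<close> by (auto simp: carrier_colored_perm_group)
    have "1 \<in> \<sigma> ` {1..n}" using permutes_image[OF \<sigma>] \<open>n > 0\<close> by simp
    then obtain c where c: "c \<in> {1..n}" "\<sigma> c = 1" by (metis imageE)
    have sc: "s c \<in> {0..<int p}" using s c(1) by blast
    define slot where "slot m \<longleftrightarrow>
      (\<forall>a\<in>{1..n}. Suc k < \<sigma> a \<longrightarrow> (if \<sigma> a \<le> m then a < c else c < a))" for m
    have "(\<Sum>j\<in>{0..<int p}. \<Sum>m\<in>{k<..n}. B n k (uninsert n p m j h))
        = (\<Sum>j\<in>{0..<int p}. \<Sum>m\<in>{k<..n}.
            if j = s c then if increasing_above n (Suc k) h \<and> slot m then 1 else 0 else 0)"
    proof (intro sum.cong refl)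
      fix j m assume "j \<in> {0..<int p}" "m \<in> {k<..n}"
      then show "B n k (uninsert n p m j h)
          = (if j = s c then if increasing_above n (Suc k) h \<and> slot m then 1 else 0 else 0)"
        using increasing_above_uninsert_high[OF x _ _ _ c, of j k m] True
        by (auto simp: B_def hs slot_def)
    qed
    also have "\<dots> = (\<Sum>m\<in>{k<..n}. if increasing_above n (Suc k) h \<and> slot m then 1 else 0)"
      using sc by (subst sum.swap) simp
    also have "\<dots> = B n (Suc k) h"
    proof (cases "increasing_above n (Suc k) h")
      case inc: True
      then obtain m0 where "m0 \<in> {k<..n}" "\<And>m. m \<in> {k<..n} \<Longrightarrow> slot m \<longleftrightarrow> m = m0"
        using insertion_slot_unique[OF x True _ c] unfolding hs slot_def by metis
      then have "(\<Sum>m\<in>{k<..n}. if slot m then 1 else 0 :: complex) = (\<Sum>m\<in>{k<..n}. if m = m0 then 1 else 0)"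
        by (intro sum.cong refl) simp
      then show ?thesis using inc True \<open>m0 \<in> _\<close> by (simp add: B_def)
    qed (simp add: B_def)
    finally show ?thesis .
  qed
  have "{1..n} = {1..k} \<union> {k<..n}" using True by auto
  then have "(\<Sum>m\<in>{1..n}. B n k (uninsert n p m j h))
      = (\<Sum>m\<in>{1..k}. B n k (uninsert n p m j h)) + (\<Sum>m\<in>{k<..n}. B n k (uninsert n p m j h))" for j
    by (subst sum.union_disjoint[symmetric]) auto
  then show ?thesis using low high by (simp add: sum.distrib)
qed

section \<open>Counting fixed points\<close>

text \<open>Fixing \<open>K\<close> restricts colors and permutation independently, so the set
  becomes a product that can be counted factor by factor.\<close>

lemma fixed_points_superset:
  assumes "p > 0" "K \<subseteq> {1..n}"
  shows "{g \<in> carrier (colored_perm_group n p). K \<subseteq> fixed_points n g}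
    = (\<Pi>\<^sub>E i\<in>{1..n}. if i \<in> K then {0} else {0..<int p}) \<times> {\<sigma>. \<sigma> permutes ({1..n} - K)}"
proof (intro equalityI subsetI)
  fix g assume g: "g \<in> {g \<in> carrier (colored_perm_group n p). K \<subseteq> fixed_points n g}"
  obtain s \<sigma> where gs: "g = (s, \<sigma>)" by (cases g)
  have s: "s \<in> {1..n} \<rightarrow>\<^sub>E {0..<int p}" and \<sigma>: "\<sigma> permutes {1..n}"
    using g assms by (auto simp: gs carrier_colored_perm_group)
  have fix_K: "s i = 0" "\<sigma> i = i" if "i \<in> K" for i
    using g that by (auto simp: gs fixed_points_def)
  have "\<sigma> permutes ({1..n} - K)" using \<sigma> by (rule permutes_superset) (use fix_K(2) in auto)
  moreover have "s \<in> (\<Pi>\<^sub>E i\<in>{1..n}. if i \<in> K then {0} else {0..<int p})"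
    using s fix_K(1) by (auto simp: PiE_iff)
  ultimately show "g \<in> (\<Pi>\<^sub>E i\<in>{1..n}. if i \<in> K then {0} else {0..<int p}) \<times> {\<sigma>. \<sigma> permutes ({1..n} - K)}"
    by (simp add: gs)
next
  fix g assume g: "g \<in> (\<Pi>\<^sub>E i\<in>{1..n}. if i \<in> K then {0} else {0..<int p}) \<times> {\<sigma>. \<sigma> permutes ({1..n} - K)}"
  obtain s \<sigma> where gs: "g = (s, \<sigma>)" by (cases g)
  have s: "s \<in> (\<Pi>\<^sub>E i\<in>{1..n}. if i \<in> K then {0} else {0..<int p})" and \<sigma>: "\<sigma> permutes ({1..n} - K)"
    using g by (auto simp: gs)
  have "\<sigma> permutes {1..n}" using \<sigma> by (rule permutes_subset) auto
  moreover have "s \<in> {1..n} \<rightarrow>\<^sub>E {0..<int p}" using s \<open>p > 0\<close> by (auto simp: PiE_iff split: if_splits)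
  moreover have "s i = 0 \<and> \<sigma> i = i" if "i \<in> K" for i
    using s that assms(2) permutes_not_in[OF \<sigma>, of i] by (auto simp: PiE_iff split: if_splits)
  ultimately show "g \<in> {g \<in> carrier (colored_perm_group n p). K \<subseteq> fixed_points n g}"
    using assms by (auto simp: gs carrier_colored_perm_group fixed_points_def)
qed

lemma card_fixed_points_superset:
  assumes "p > 0" "K \<subseteq> {1..n}"
  shows "card {g \<in> carrier (colored_perm_group n p). K \<subseteq> fixed_points n g}
    = p ^ (n - card K) * fact (n - card K)"
proof -
  have "finite K" using assms(2) finite_subset by blast
  have "card ({1..n} - K) = n - card K" using assms(2) \<open>finite K\<close> by (simp add: card_Diff_subset)
  moreover have "(\<Prod>i\<in>{1..n}. card (if i \<in> K then {0} else {0..<int p})) = p ^ card ({1..n} - K)"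
  proof -
    have "(\<Prod>i\<in>{1..n}. card (if i \<in> K then {0} else {0..<int p}))
        = (\<Prod>i\<in>{1..n} - K. card (if i \<in> K then {0} else {0..<int p}))"
      by (rule prod.mono_neutral_right) auto
    also have "\<dots> = p ^ card ({1..n} - K)" by simp
    finally show ?thesis .
  qed
  ultimately show ?thesis
    unfolding fixed_points_superset[OF assms]
    by (simp add: card_cartesian_product card_PiE card_permutations)
qed

text \<open>Double counting of the pairs of a group element and a \<open>k\<close>-subset of its
  fixed points.\<close>

lemma sum_choose_card_fixed_points:
  assumes "p > 0" "k \<le> n"
  shows "(\<Sum>g\<in>carrier (colored_perm_group n p). card (fixed_points n g) choose k)
    = (n choose k) * (p ^ (n - k) * fact (n - k))"
proof -
  let ?G = "carrier (colored_perm_group n p)" and ?S = "{K. K \<subseteq> {1..n} \<and> card K = k}"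
  have fin: "finite ?G" using finite_colored_perm_group[OF \<open>p > 0\<close>] .
  have finS: "finite ?S" by (rule finite_subset[of _ "Pow {1..n}"]) auto
  have "(card (fixed_points n g) choose k) = (\<Sum>K\<in>?S. if K \<subseteq> fixed_points n g then 1 else 0)" for g
  proof -
    have sub: "fixed_points n g \<subseteq> {1..n}" by (auto simp: fixed_points_def split: prod.splits)
    then have "finite (fixed_points n g)" using finite_subset by blast
    then have "(card (fixed_points n g) choose k) = card {K. K \<subseteq> fixed_points n g \<and> card K = k}"
      by (simp add: n_subsets)
    also have "{K. K \<subseteq> fixed_points n g \<and> card K = k} = {K \<in> ?S. K \<subseteq> fixed_points n g}"
      using sub by auto
    finally show ?thesis using finS by (simp add: sum.If_cases Int_def)
  qed
  then have "(\<Sum>g\<in>?G. card (fixed_points n g) choose k)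
      = (\<Sum>K\<in>?S. \<Sum>g\<in>?G. if K \<subseteq> fixed_points n g then 1 else 0)"
    by (simp only: sum.swap[of _ ?S])
  also have "\<dots> = (\<Sum>K\<in>?S. card {g \<in> ?G. K \<subseteq> fixed_points n g})"
    using fin by (simp add: sum.If_cases Int_def)
  also have "\<dots> = (\<Sum>K\<in>?S. p ^ (n - k) * fact (n - k))"
    using card_fixed_points_superset[OF \<open>p > 0\<close>] by (intro sum.cong) auto
  also have "\<dots> = (n choose k) * (p ^ (n - k) * fact (n - k))"
    by (simp add: n_subsets)
  finally show ?thesis .
qed

lemma card_colored_perm_group:
  assumes "p > 0"
  shows "card (carrier (colored_perm_group n p)) = p ^ n * fact n"
  using card_fixed_points_superset[OF assms, of "{}" n] by simp

text \<open>Binomial inversion of these pair counts. The right-hand side is the trace formula for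
  the multiplicity of \<open>i p\<close>, with every trace equal to the group order.\<close>

lemma card_exact_fixed_points:
  assumes "p > 0" "i \<le> n"
  shows "of_nat (card {g \<in> carrier (colored_perm_group n p). card (fixed_points n g) = i})
    = (\<Sum>k\<le>n. inversion_coeff p i k * of_nat (card (carrier (colored_perm_group n p))))"
proof -
  let ?G = "carrier (colored_perm_group n p)"
  have fin: "finite ?G" using finite_colored_perm_group[OF \<open>p > 0\<close>] .
  have le: "card (fixed_points n g) \<le> n" for g
  proof -
    have "fixed_points n g \<subseteq> {1..n}" by (auto simp: fixed_points_def split: prod.splits)
    then show ?thesis using card_mono[of "{1..n}"] by fastforce
  qed
  have "(\<Sum>g\<in>?G. if card (fixed_points n g) = i then 1 else 0 :: complex)
      = (\<Sum>g\<in>?G. \<Sum>k\<le>n. (-1) ^ (k + i) * of_nat (k choose i) * of_nat (card (fixed_points n g) choose k))"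
    by (simp only: sum_alternating_choose_choose[OF le])
  also have "\<dots> = (\<Sum>k\<le>n. (-1) ^ (k + i) * of_nat (k choose i)
      * of_nat (\<Sum>g\<in>?G. card (fixed_points n g) choose k))"
    by (subst sum.swap) (simp add: sum_distrib_left)
  also have "\<dots> = (\<Sum>k\<le>n. inversion_coeff p i k * of_nat (card ?G))"
  proof (intro sum.cong refl)
    fix k assume "k \<in> {..n}"
    then have k: "k \<le> n" by simp
    \<comment> \<open>The number of pairs is the group order divided by \<open>p ^ k * k!\<close>,
      which is the denominator of \<open>inversion_coeff\<close>.\<close>
    have "of_nat (\<Sum>g\<in>?G. card (fixed_points n g) choose k)
        = (fact n / (fact k * fact (n - k))) * (of_nat p ^ (n - k) * fact (n - k) :: complex)"
      unfolding sum_choose_card_fixed_points[OF \<open>p > 0\<close> k] using k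
      by (simp add: binomial_fact)
    also have "\<dots> = of_nat p ^ n * fact n / (of_nat p ^ k * fact k)"
      using \<open>p > 0\<close> k by (simp add: power_diff field_simps)
    finally show "(-1) ^ (k + i) * of_nat (k choose i) * of_nat (\<Sum>g\<in>?G. card (fixed_points n g) choose k)
        = inversion_coeff p i k * (of_nat (card ?G) :: complex)"
      by (simp add: inversion_coeff_def card_colored_perm_group[OF \<open>p > 0\<close>])
  qed
  finally show ?thesis using fin by (simp add: sum.If_cases Int_def)
qed

text \<open>The witness is the identity permutation with color 1 on the last \<open>n - i\<close>
  places; \<open>p \<ge> 2\<close> makes this color available.\<close>

lemma ex_exact_fixed_points:
  assumes "p \<ge> 2" "i \<le> n"
  shows "\<exists>g\<in>carrier (colored_perm_group n p). card (fixed_points n g) = i"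
proof
  let ?g = "(\<lambda>a\<in>{1..n}. if a \<le> i then 0 else 1, id)"
  show "?g \<in> carrier (colored_perm_group n p)"
    using assms by (subst carrier_colored_perm_group) (auto simp: permutes_id)
  have "fixed_points n ?g = {1..i}" using assms(2) by (auto simp: fixed_points_def)
  then show "card (fixed_points n ?g) = i" by simp
qed

section \<open>Spectrum and multiplicities\<close>

text \<open>The matrix of the left regular action of \<open>B n k\<close>: substituting
  \<open>y\<close> for the inverse of \<open>g\<close> times \<open>x\<close> in the defining sum
  gives the coefficient at \<open>x\<close> times the inverse of \<open>y\<close>.\<close>

definition B_kernel :: "nat \<Rightarrow> nat \<Rightarrow> nat \<Rightarrow> colored_perm \<Rightarrow> colored_perm \<Rightarrow> complex" where
  "B_kernel n p k x y =
    (if x \<in> carrier (colored_perm_group n p)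
     then B n k (x \<otimes>\<^bsub>colored_perm_group n p\<^esub> inv\<^bsub>colored_perm_group n p\<^esub> y) else 0)"

lemma falling_factorial_family_B1:
  assumes "p > 0" "n > 0"
  shows "falling_factorial_family (carrier (colored_perm_group n p))
    (left_regular_algebra (colored_perm_group n p) (B1 n p)) (B_kernel n p) n p"
proof
  let ?G = "colored_perm_group n p"
  let ?T = "left_regular_algebra ?G (B1 n p)"
  interpret G: group ?G by (rule group_colored_perm_group)
  show "finite (carrier ?G)" by (rule finite_colored_perm_group[OF \<open>p > 0\<close>])
  show "p > 0" by fact
  show "?T (f + g) = ?T f + ?T g" for f g
    by (simp add: fun_eq_iff left_regular_algebra_B1[OF assms] sum.distrib)
  show "?T (scale_fun c f) = scale_fun c (?T f)" for c f
    by (simp add: fun_eq_iff left_regular_algebra_B1[OF assms] scale_fun_def sum_distrib_left)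
  show "B_kernel n p k x y = 0" if "x \<notin> carrier ?G" for k x y
    using that by (simp add: B_kernel_def)
  show "B_kernel n p 0 x y = (if x = y then 1 else 0)" if "x \<in> carrier ?G" "y \<in> carrier ?G" for x y
  proof -
    have "x \<otimes>\<^bsub>?G\<^esub> inv\<^bsub>?G\<^esub> y = \<one>\<^bsub>?G\<^esub> \<longleftrightarrow> x = y"
      using that by (metis G.inv_closed G.inv_equality G.inv_inv G.r_inv)
    then show ?thesis
      using that by (simp add: B_kernel_def B_def increasing_above_0[of _ n p])
  qed
  show "B_kernel n p k x y = 0" if "k > n" for k x y
    using that by (simp add: B_kernel_def B_def)
  show "?T (\<lambda>x. B_kernel n p k x y)
      = (\<lambda>x. of_nat (k * p) * B_kernel n p k x y + B_kernel n p (Suc k) x y)"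
    if y: "y \<in> carrier ?G" for k y
  proof
    fix x
    show "?T (\<lambda>x. B_kernel n p k x y) x
        = of_nat (k * p) * B_kernel n p k x y + B_kernel n p (Suc k) x y"
    proof (cases "x \<in> carrier ?G")
      case x: True
      let ?h = "x \<otimes>\<^bsub>?G\<^esub> inv\<^bsub>?G\<^esub> y"
      have h: "?h \<in> carrier ?G" using x y by simp
      \<comment> \<open>\<open>uninsert\<close> is a left multiplication and the passage from
        \<open>x\<close> to \<open>?h\<close> a right multiplication; the two commute.\<close>
      have "B_kernel n p k (uninsert n p m j x) y = B n k (uninsert n p m j ?h)"
        if "j \<in> {0..<int p}" "m \<in> {1..n}" for j m
        using x y h uninsert_closed[OF \<open>p > 0\<close> that(2) x] insertion_closed[OF that(2,1)]
        by (simp add: B_kernel_def uninsert_eq[OF that(2,1)] G.m_assoc)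
      then have "?T (\<lambda>x. B_kernel n p k x y) x
          = (\<Sum>j\<in>{0..<int p}. \<Sum>m\<in>{1..n}. B n k (uninsert n p m j ?h))"
        unfolding left_regular_algebra_B1[OF assms] using x by simp
      then show ?thesis using sum_B_uninsert[OF assms h] x by (simp add: B_kernel_def)
    next
      case False
      then show ?thesis by (simp add: left_regular_algebra_B1[OF assms] B_kernel_def)
    qed
  qed
qed

text \<open>Every diagonal entry is the coefficient of the identity, which is 1.\<close>

lemma trace_B_kernel:
  assumes "k \<le> n"
  shows "(\<Sum>y\<in>carrier (colored_perm_group n p). B_kernel n p k y y)
    = of_nat (card (carrier (colored_perm_group n p)))"
proof -
  interpret G: group "colored_perm_group n p" by (rule group_colored_perm_group)
  show ?thesis using assms by (simp add: B_kernel_def B_def increasing_above_one)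
qed

text \<open>For \<open>p = 1\<close> no permutation has exactly \<open>n - 1\<close> fixed points,
  so \<open>n - 1\<close> has multiplicity 0 and is not an eigenvalue; for \<open>p \<ge> 2\<close>
  all the counts are positive and the whole list occurs.\<close>

theorem theorem1:
  fixes n p :: nat
  assumes "n \<ge> 2" and "p \<ge> 1"
  shows
    "let G = colored_perm_group n p;
         T = left_regular_algebra G (B1 n p)
     in eigenvalues (L2 G) T \<subseteq> {of_nat (i * p) | i. i \<le> n} \<and>
        (p \<ge> 2 \<longrightarrow> eigenvalues (L2 G) T = {of_nat (i * p) | i. i \<le> n}) \<and>
        (\<forall>i\<le>n.
           algebraic_multiplicity (L2 G) T (of_nat (i * p))
             = card {g \<in> carrier G. card (fixed_points n g) = i} \<and>
           geometric_multiplicity (L2 G) T (of_nat (i * p))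
             = card {g \<in> carrier G. card (fixed_points n g) = i})"
proof -
  define G where "G = colored_perm_group n p"
  define T where "T = left_regular_algebra G (B1 n p)"
  have pos: "p > 0" "n > 0" using assms by auto
  interpret falling_factorial_family "carrier G" T "B_kernel n p" n p
    unfolding G_def T_def by (rule falling_factorial_family_B1[OF pos])
  have V: "L2 G = V" by (simp add: L2_def V_def)
  have mult: "geometric_multiplicity V T (of_nat (i * p))
      = card {g \<in> carrier G. card (fixed_points n g) = i}" if "i \<le> n" for i
  proof -
    have "of_nat (geometric_multiplicity V T (of_nat (i * p)))
        = (\<Sum>k\<le>n. inversion_coeff p i k * of_nat (card (carrier G)))"
      unfolding geometric_multiplicity_eq[OF that]
      by (intro sum.cong refl) (simp add: G_def trace_B_kernel)
    also have "\<dots> = of_nat (card {g \<in> carrier G. card (fixed_points n g) = i})"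
      unfolding G_def card_exact_fixed_points[OF \<open>p > 0\<close> that] ..
    finally show ?thesis by (simp only: of_nat_eq_iff)
  qed
  have "of_nat (i * p) \<in> eigenvalues V T" if "i \<le> n" "p \<ge> 2" for i
  proof (rule ccontr)
    assume "of_nat (i * p) \<notin> eigenvalues V T"
    \<comment> \<open>Without an eigenvector the eigenspace has dimension 0, against the positive
      number of group elements with exactly \<open>i\<close> fixed points.\<close>
    then have "{f \<in> V. T f = scale_fun (of_nat (i * p)) f} \<subseteq> {0}"
      unfolding eigenvalues_def by blast
    then have "geometric_multiplicity V T (of_nat (i * p)) = 0"
      using fun_space.dim_le_card[of _ "{}"] by (simp add: geometric_multiplicity_def)
    then have "card {g \<in> carrier G. card (fixed_points n g) = i} = 0" using mult[OF that(1)] by simp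
    then show False
      using ex_exact_fixed_points[OF that(2,1)] finite_A unfolding G_def by auto
  qed
  then show ?thesis
    using eigenvalues_subset mult algebraic_eq_geometric_multiplicity
    unfolding Let_def G_def[symmetric] T_def[symmetric] V by auto
qed

end
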